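(* Let $m\ge2$, let $p$ be an odd prime, and let $V'(\mathbb Z_p)=\mathbb Z_p^{2m+1}$ with coordinates $(u_1,\dots,u_m,v_1,\dots,v_m,u_0)$ and quadratic form $q=u_1v_1+\dots+u_mv_m+u_0^2$. Let $\eta\in V'(\mathbb Z_p)$ with $q(\eta)\ne0$, let $k\ge0$ be such that $p^k$ exactly divides $\eta$, define $k'$ by $p^{2k+k'}\|q(\eta)$, and put $q(\eta)_1=q(\eta)/p^{2k+k'}$. Let $\chi_\eta(p)=\big(\frac{q(\eta)_1}{p}\big)$ (Legendre symbol) if $2k+k'$ is even and $\chi_\eta(p)=0$ if $2k+k'$ is odd. Then $$J(s,\eta,\Phi_p)=\frac{1-p^{2(m-s)}}{1-\chi_\eta(p)p^{m-s}}\,Q_{\eta,p}(p^{m-s}),$$ where $Q_{\eta,p}(X)\in\mathbb Z[X]$ has degree $2\lfloor\frac{2k+k'}{2}\rfloor$ and satisfies $p^LX^{2L}Q_{\eta,p}(p^{-1}X^{-1})=Q_{\eta,p}(X)$, with $L=\lfloor\frac{2k+k'}{2}\rfloor$.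
   Context: $(x,y)=q(x+y)-q(x)-q(y)$ is the associated bilinear form. $\Phi_p$ is the characteristic function of $V'(\mathbb Z_p)$, $\psi_p(x)=e^{2\pi i\{x\}_p}$, $dx$ the Haar measure on $V'(\mathbb Q_p)=\mathbb Q_p^{2m+1}$ with $\mathrm{vol}(V'(\mathbb Z_p))=1$, and $J(s,\eta,\Phi_p)=\sum_{r\ge0}p^{-rs}\int_{p^{-r}V'(\mathbb Z_p)}\psi_p((\eta,x))\mathbf 1[p^rq(x)\in\mathbb Z_p]\,dx$. "$p^k$ exactly divides $\eta$" means $k$ is the minimum of the $p$-adic valuations of the coordinates of $\eta$. *)

theory Defs
  imports "HOL-Analysis.Analysis" "HOL-Number_Theory.Number_Theory"
    "Berlekamp_Zassenhaus.Finite_Field"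
begin

section \<open>The p-adic absolute value on the rationals\<close>

definition rat_pabs :: "nat \<Rightarrow> rat \<Rightarrow> real" where
  "rat_pabs p r = (if r = 0 then 0 else
     real p powi (int (multiplicity (int p) (snd (quotient_of r)))
                - int (multiplicity (int p) (fst (quotient_of r)))))"

context
  fixes p :: nat
  assumes p: "prime p"
begin

lemma rat_pabs_0 [simp]: "rat_pabs p 0 = 0"
  by (simp add: rat_pabs_def)

lemma rat_pabs_pos: "r \<noteq> 0 \<Longrightarrow> rat_pabs p r > 0"
  using p by (simp add: rat_pabs_def prime_gt_0_nat)

lemma rat_pabs_nonneg: "rat_pabs p r \<ge> 0"
  using rat_pabs_pos[of r] by (cases "r = 0") auto

lemma rat_pabs_frac:
  fixes a b :: int
  assumes "a \<noteq> 0" "b \<noteq> 0"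
  shows "rat_pabs p (of_int a / of_int b)
         = real p powi (int (multiplicity (int p) b) - int (multiplicity (int p) a))"
proof -
  define r :: rat where "r = of_int a / of_int b"
  obtain c d where cd: "quotient_of r = (c, d)" by (cases "quotient_of r")
  have d: "d > 0" using quotient_of_denom_pos[OF cd] .
  have r: "r = of_int c / of_int d" using quotient_of_div[OF cd] .
  have r0: "r \<noteq> 0" using assms by (simp add: r_def)
  hence c: "c \<noteq> 0" using r by auto
  have "(of_int a :: rat) * of_int d = of_int c * of_int b"
    using r r_def assms d by (simp add: field_simps)
  hence eq: "a * d = c * b" by (metis of_int_eq_iff of_int_mult)
  have pp: "prime_elem (int p)" using p by simp
  have "multiplicity (int p) (a * d) = multiplicity (int p) a + multiplicity (int p) d"
    using pp assms d by (intro prime_elem_multiplicity_mult_distrib) auto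
  moreover have "multiplicity (int p) (c * b) = multiplicity (int p) c + multiplicity (int p) b"
    using pp assms c by (intro prime_elem_multiplicity_mult_distrib) auto
  ultimately have *: "int (multiplicity (int p) d) - int (multiplicity (int p) c)
      = int (multiplicity (int p) b) - int (multiplicity (int p) a)"
    using eq by simp
  have "rat_pabs p r = real p powi (int (multiplicity (int p) d) - int (multiplicity (int p) c))"
    using r0 cd by (simp add: rat_pabs_def)
  thus ?thesis unfolding * by (simp add: r_def)
qed

lemma rat_pabs_int_le_iff: "rat_pabs p (of_int z) \<le> 1 / real p ^ n \<longleftrightarrow> int p ^ n dvd z"
proof (cases "z = 0")
  case True
  thus ?thesis by (simp add: rat_pabs_def)
next
  case False
  have p1: "real p > 1" using p prime_gt_1_nat[of p] by simp
  have "rat_pabs p (of_int z) = 1 / real p ^ multiplicity (int p) z"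
    using rat_pabs_frac[of z 1] False by (simp add: power_int_minus divide_inverse)
  hence "rat_pabs p (of_int z) \<le> 1 / real p ^ n \<longleftrightarrow> real p ^ n \<le> real p ^ multiplicity (int p) z"
    using p1 by (simp only:) (simp add: divide_simps)
  also have "\<dots> \<longleftrightarrow> n \<le> multiplicity (int p) z" using p1 by (rule power_increasing_iff)
  also have "\<dots> \<longleftrightarrow> int p ^ n dvd z"
    using False p by (intro power_dvd_iff_le_multiplicity[symmetric]) auto
  finally show ?thesis .
qed

lemma rat_pabs_1 [simp]: "rat_pabs p 1 = 1"
  using rat_pabs_frac[of 1 1] by simp

lemma rat_pabs_minus [simp]: "rat_pabs p (- r) = rat_pabs p r"
proof (cases "r = 0")
  case False
  obtain a b where ab: "quotient_of r = (a, b)" by (cases "quotient_of r")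
  have b: "b > 0" and r: "r = of_int a / of_int b"
    using quotient_of_denom_pos[OF ab] quotient_of_div[OF ab] by auto
  have a: "a \<noteq> 0" using False r by auto
  have ma: "multiplicity (int p) (- a) = multiplicity (int p) a"
    using multiplicity_normalize_right[of "int p" "- a"] multiplicity_normalize_right[of "int p" a]
    by simp
  show ?thesis using rat_pabs_frac[of a b] rat_pabs_frac[of "-a" b] a b
    by (simp add: r ma)
qed simp

lemma rat_pabs_mult: "rat_pabs p (r * s) = rat_pabs p r * rat_pabs p s"
proof (cases "r = 0 \<or> s = 0")
  case False
  obtain a b where ab: "quotient_of r = (a, b)" by (cases "quotient_of r")
  obtain c d where cd: "quotient_of s = (c, d)" by (cases "quotient_of s")
  have b: "b > 0" and r: "r = of_int a / of_int b"
    using quotient_of_denom_pos[OF ab] quotient_of_div[OF ab] by auto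
  have d: "d > 0" and s: "s = of_int c / of_int d"
    using quotient_of_denom_pos[OF cd] quotient_of_div[OF cd] by auto
  have a: "a \<noteq> 0" and c: "c \<noteq> 0" using False r s by auto
  have rs: "r * s = of_int (a * c) / of_int (b * d)" by (simp add: r s)
  have pp: "prime_elem (int p)" using p by simp
  have p0: "real p \<noteq> 0" using p by (simp add: prime_gt_0_nat)
  show ?thesis
    unfolding rs using a b c d pp p0 rat_pabs_frac[of "a*c" "b*d"]
      rat_pabs_frac[of a b] rat_pabs_frac[of c d]
    by (simp add: r s prime_elem_multiplicity_mult_distrib power_int_diff power_int_add)
qed auto

lemma rat_pabs_inverse: "rat_pabs p (inverse r) = inverse (rat_pabs p r)"
proof (cases "r = 0")
  case False
  have "rat_pabs p (inverse r) * rat_pabs p r = 1"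
    using False by (simp flip: rat_pabs_mult)
  thus ?thesis by (metis inverse_unique mult.commute)
qed simp

lemma rat_pabs_add: "rat_pabs p (r + s) \<le> max (rat_pabs p r) (rat_pabs p s)"
proof (cases "r = 0 \<or> s = 0 \<or> r + s = 0")
  case True
  then show ?thesis using rat_pabs_nonneg[of r] rat_pabs_nonneg[of s]
    by (auto simp: max_def)
next
  case False
  obtain a b where ab: "quotient_of r = (a, b)" by (cases "quotient_of r")
  obtain c d where cd: "quotient_of s = (c, d)" by (cases "quotient_of s")
  have b: "b > 0" and r: "r = of_int a / of_int b"
    using quotient_of_denom_pos[OF ab] quotient_of_div[OF ab] by auto
  have d: "d > 0" and s: "s = of_int c / of_int d"
    using quotient_of_denom_pos[OF cd] quotient_of_div[OF cd] by auto
  have r': "r = of_int (a * d) / of_int (b * d)" and s': "s = of_int (c * b) / of_int (b * d)"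
    using b d by (auto simp: r s)
  define A where "A = a * d"
  define C where "C = c * b"
  define B where "B = b * d"
  have B: "B \<noteq> 0" using b d by (simp add: B_def)
  have rA: "r = of_int A / of_int B" and sC: "s = of_int C / of_int B"
    using r' s' by (auto simp: A_def B_def C_def)
  have rs: "r + s = of_int (A + C) / of_int B" by (simp add: rA sC add_divide_distrib)
  have nz: "A \<noteq> 0" "C \<noteq> 0" "A + C \<noteq> 0" using False rA sC rs by auto
  let ?m = "\<lambda>x. multiplicity (int p) x"
  have nu: "\<not> is_unit (int p)" using p by auto
  have "int p ^ min (?m A) (?m C) dvd A + C"
    by (intro dvd_add) (auto intro: multiplicity_dvd')
  hence "min (?m A) (?m C) \<le> ?m (A + C)"
    using nz nu by (intro multiplicity_geI) auto
  hence "?m A \<le> ?m (A + C) \<or> ?m C \<le> ?m (A + C)" by linarith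
  moreover have p1: "real p \<ge> 1" using p prime_gt_0_nat[of p] by simp
  ultimately have "real p powi (int (?m B) - int (?m (A + C))) \<le> real p powi (int (?m B) - int (?m A))
     \<or> real p powi (int (?m B) - int (?m (A + C))) \<le> real p powi (int (?m B) - int (?m C))"
    by (auto intro!: power_int_increasing)
  moreover have "rat_pabs p r = real p powi (int (?m B) - int (?m A))"
    unfolding rA using nz B by (intro rat_pabs_frac)
  moreover have "rat_pabs p s = real p powi (int (?m B) - int (?m C))"
    unfolding sC using nz B by (intro rat_pabs_frac)
  moreover have "rat_pabs p (r + s) = real p powi (int (?m B) - int (?m (A + C)))"
    unfolding rs using nz B by (intro rat_pabs_frac)
  ultimately show ?thesis by (simp only: le_max_iff_disj)
qed

lemma rat_pabs_triangle: "rat_pabs p (r + s) \<le> rat_pabs p r + rat_pabs p s"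
  using rat_pabs_add[of r s] rat_pabs_nonneg[of r] rat_pabs_nonneg[of s] by linarith

lemma rat_pabs_diff_commute: "rat_pabs p (r - s) = rat_pabs p (s - r)"
  using rat_pabs_minus[of "r - s"] by simp

lemma rat_pabs_abs_diff: "\<bar>rat_pabs p r - rat_pabs p s\<bar> \<le> rat_pabs p (r - s)"
  using rat_pabs_triangle[of "r - s" s] rat_pabs_triangle[of "s - r" r]
    rat_pabs_diff_commute[of r s] by (simp add: abs_le_iff)

end


section \<open>The field of p-adic numbers as the completion of the rationals\<close>

definition pvanishes :: "nat \<Rightarrow> (nat \<Rightarrow> rat) \<Rightarrow> bool" where
  "pvanishes p X \<longleftrightarrow> (\<lambda>n. rat_pabs p (X n)) \<longlonglongrightarrow> 0"

definition pcauchy :: "nat \<Rightarrow> (nat \<Rightarrow> rat) \<Rightarrow> bool" where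
  "pcauchy p X \<longleftrightarrow> (\<forall>e>0. \<exists>N. \<forall>m\<ge>N. \<forall>n\<ge>N. rat_pabs p (X m - X n) < e)"

context
  fixes p :: nat
  assumes p: "prime p"
begin

lemma pvanishes_le:
  assumes "pvanishes p X" "\<And>n. rat_pabs p (Y n) \<le> c * rat_pabs p (X n)"
  shows "pvanishes p Y"
proof -
  have "(\<lambda>n. c * rat_pabs p (X n)) \<longlonglongrightarrow> c * 0"
    using assms(1) unfolding pvanishes_def by (intro tendsto_intros)
  thus ?thesis unfolding pvanishes_def using assms(2) rat_pabs_nonneg[OF p]
    by - (rule tendsto_sandwich[of "\<lambda>_. 0" _ _ "\<lambda>n. c * rat_pabs p (X n)"], auto)
qed

lemma pvanishes_add:
  assumes "pvanishes p X" "pvanishes p Y"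
  shows "pvanishes p (\<lambda>n. X n + Y n)"
proof -
  have "(\<lambda>n. rat_pabs p (X n) + rat_pabs p (Y n)) \<longlonglongrightarrow> 0 + 0"
    using assms unfolding pvanishes_def by (intro tendsto_intros)
  thus ?thesis unfolding pvanishes_def
    using rat_pabs_nonneg[OF p] rat_pabs_triangle[OF p]
    by - (rule tendsto_sandwich[of "\<lambda>_. 0" _ _ "\<lambda>n. rat_pabs p (X n) + rat_pabs p (Y n)"], auto)
qed

lemma pvanishes_minus: "pvanishes p X \<Longrightarrow> pvanishes p (\<lambda>n. - X n)"
  unfolding pvanishes_def by (simp add: rat_pabs_minus[OF p])

lemma pvanishes_const_0: "pvanishes p (\<lambda>n. 0)"
  by (simp add: pvanishes_def rat_pabs_0[OF p])

lemma pcauchy_const: "pcauchy p (\<lambda>n. c)"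
  unfolding pcauchy_def by (simp add: rat_pabs_0[OF p])

lemma pcauchy_add:
  assumes "pcauchy p X" "pcauchy p Y"
  shows "pcauchy p (\<lambda>n. X n + Y n)"
  unfolding pcauchy_def
proof (intro allI impI)
  fix e :: real assume e: "e > 0"
  obtain M where M: "\<And>m n. m \<ge> M \<Longrightarrow> n \<ge> M \<Longrightarrow> rat_pabs p (X m - X n) < e"
    using assms(1) e unfolding pcauchy_def by meson
  obtain N where N: "\<And>m n. m \<ge> N \<Longrightarrow> n \<ge> N \<Longrightarrow> rat_pabs p (Y m - Y n) < e"
    using assms(2) e unfolding pcauchy_def by meson
  have "rat_pabs p (X m + Y m - (X n + Y n)) < e" if "m \<ge> max M N" "n \<ge> max M N" for m n
  proof -
    have eq: "X m + Y m - (X n + Y n) = (X m - X n) + (Y m - Y n)" by simp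
    show ?thesis unfolding eq using rat_pabs_add[OF p, of "X m - X n" "Y m - Y n"] M[of m n] N[of m n] that
      by simp
  qed
  thus "\<exists>N. \<forall>m\<ge>N. \<forall>n\<ge>N. rat_pabs p (X m + Y m - (X n + Y n)) < e" by blast
qed

lemma pcauchy_minus:
  assumes "pcauchy p X" shows "pcauchy p (\<lambda>n. - X n)"
proof -
  have "rat_pabs p (- X m - - X n) = rat_pabs p (X m - X n)" for m n
    using rat_pabs_diff_commute[OF p, of "X n" "X m"] by simp
  thus ?thesis using assms unfolding pcauchy_def by simp
qed

lemma pcauchy_norm_Cauchy:
  assumes "pcauchy p X" shows "Cauchy (\<lambda>n. rat_pabs p (X n))"
  unfolding Cauchy_def dist_real_def
proof (intro allI impI)
  fix e :: real assume "e > 0"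
  then obtain N where N: "\<forall>m\<ge>N. \<forall>n\<ge>N. rat_pabs p (X m - X n) < e"
    using assms unfolding pcauchy_def by blast
  show "\<exists>M. \<forall>m\<ge>M. \<forall>n\<ge>M. \<bar>rat_pabs p (X m) - rat_pabs p (X n)\<bar> < e"
    using N rat_pabs_abs_diff[OF p] by (meson le_less_trans)
qed

lemma pcauchy_norm_tendsto:
  "pcauchy p X \<Longrightarrow> (\<lambda>n. rat_pabs p (X n)) \<longlonglongrightarrow> lim (\<lambda>n. rat_pabs p (X n))"
  using pcauchy_norm_Cauchy Cauchy_convergent convergent_LIMSEQ_iff by blast

lemma pcauchy_bounded:
  assumes "pcauchy p X" obtains B where "B > 0" "\<And>n. rat_pabs p (X n) \<le> B"
proof -
  have "Bseq (\<lambda>n. rat_pabs p (X n))"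
    using pcauchy_norm_Cauchy[OF assms] Cauchy_Bseq by blast
  then obtain B where "B > 0" "\<forall>n. norm (rat_pabs p (X n)) \<le> B" unfolding Bseq_def by blast
  thus ?thesis using that[of B] by (auto simp: abs_le_iff)
qed

lemma pcauchy_mult:
  assumes "pcauchy p X" "pcauchy p Y"
  shows "pcauchy p (\<lambda>n. X n * Y n)"
  unfolding pcauchy_def
proof (intro allI impI)
  fix e :: real assume e: "e > 0"
  obtain A where A: "A > 0" "\<And>n. rat_pabs p (X n) \<le> A" using pcauchy_bounded[OF assms(1)] by metis
  obtain B where B: "B > 0" "\<And>n. rat_pabs p (Y n) \<le> B" using pcauchy_bounded[OF assms(2)] by metis
  have "e / B > 0" "e / A > 0" using e A B by auto
  obtain M where M: "\<And>m n. m \<ge> M \<Longrightarrow> n \<ge> M \<Longrightarrow> rat_pabs p (X m - X n) < e / B"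
    using assms(1) \<open>e / B > 0\<close> unfolding pcauchy_def by meson
  obtain N where N: "\<And>m n. m \<ge> N \<Longrightarrow> n \<ge> N \<Longrightarrow> rat_pabs p (Y m - Y n) < e / A"
    using assms(2) \<open>e / A > 0\<close> unfolding pcauchy_def by meson
  have "rat_pabs p (X m * Y m - X n * Y n) < e" if mn: "m \<ge> max M N" "n \<ge> max M N" for m n
  proof -
    have eq: "X m * Y m - X n * Y n = (X m - X n) * Y m + X n * (Y m - Y n)"
      by (simp add: algebra_simps)
    have "rat_pabs p ((X m - X n) * Y m) \<le> rat_pabs p (X m - X n) * B"
      using B rat_pabs_nonneg[OF p] by (simp add: rat_pabs_mult[OF p] mult_left_mono)
    also have "\<dots> < e / B * B" using M[of m n] mn B by (intro mult_strict_right_mono) auto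
    finally have 1: "rat_pabs p ((X m - X n) * Y m) < e" using B by simp
    have "rat_pabs p (X n * (Y m - Y n)) \<le> A * rat_pabs p (Y m - Y n)"
      using A rat_pabs_nonneg[OF p] by (simp add: rat_pabs_mult[OF p] mult_right_mono)
    also have "\<dots> < A * (e / A)" using N[of m n] mn A by (intro mult_strict_left_mono) auto
    finally have 2: "rat_pabs p (X n * (Y m - Y n)) < e" using A by simp
    show ?thesis unfolding eq
      using 1 2 rat_pabs_add[OF p, of "(X m - X n) * Y m" "X n * (Y m - Y n)"] by linarith
  qed
  thus "\<exists>N. \<forall>m\<ge>N. \<forall>n\<ge>N. rat_pabs p (X m * Y m - X n * Y n) < e" by blast
qed

lemma pvanishes_mult_left:
  assumes "pcauchy p X" "pvanishes p Y"
  shows "pvanishes p (\<lambda>n. X n * Y n)"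
proof -
  obtain A where A: "A > 0" "\<And>n. rat_pabs p (X n) \<le> A" using pcauchy_bounded[OF assms(1)] by metis
  show ?thesis
    using A rat_pabs_nonneg[OF p]
    by (intro pvanishes_le[OF assms(2), of _ A]) (simp add: rat_pabs_mult[OF p] mult_right_mono)
qed

lemma pcauchy_not_vanishes:
  assumes X: "pcauchy p X" and nz: "\<not> pvanishes p X"
  obtains b N where "b > 0" "\<And>n. n \<ge> N \<Longrightarrow> rat_pabs p (X n) > b"
proof -
  define l where "l = lim (\<lambda>n. rat_pabs p (X n))"
  have l: "(\<lambda>n. rat_pabs p (X n)) \<longlonglongrightarrow> l" using pcauchy_norm_tendsto[OF X] by (simp add: l_def)
  have "l \<noteq> 0" using l nz unfolding pvanishes_def by auto
  moreover have "l \<ge> 0" using l rat_pabs_nonneg[OF p] by (intro LIMSEQ_le_const) auto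
  ultimately have "l > 0" by simp
  have "\<forall>\<^sub>F n in sequentially. rat_pabs p (X n) > l / 2"
    using l \<open>l > 0\<close> by (intro order_tendstoD) auto
  thus ?thesis using that[of "l/2"] \<open>l > 0\<close> unfolding eventually_sequentially by force
qed

lemma rat_pabs_inverse_diff:
  assumes "r \<noteq> 0" "s \<noteq> 0"
  shows "rat_pabs p (inverse r - inverse s)
       = inverse (rat_pabs p r) * rat_pabs p (r - s) * inverse (rat_pabs p s)"
proof -
  have "inverse r - inverse s = - (inverse r * (r - s) * inverse s)"
    using assms by (rule inverse_diff_inverse)
  thus ?thesis by (simp add: rat_pabs_minus[OF p] rat_pabs_mult[OF p] rat_pabs_inverse[OF p])
qed

lemma pcauchy_inverse:
  assumes X: "pcauchy p X" and nz: "\<not> pvanishes p X"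
  shows "pcauchy p (\<lambda>n. inverse (X n))"
  unfolding pcauchy_def
proof (intro allI impI)
  fix e :: real assume e: "e > 0"
  obtain b M where b: "b > 0" and M: "\<And>n. n \<ge> M \<Longrightarrow> rat_pabs p (X n) > b"
    using pcauchy_not_vanishes[OF assms] by metis
  have "e * b * b > 0" using e b by simp
  then obtain N where N: "\<And>m n. m \<ge> N \<Longrightarrow> n \<ge> N \<Longrightarrow> rat_pabs p (X m - X n) < e * b * b"
    using X unfolding pcauchy_def by meson
  have "rat_pabs p (inverse (X m) - inverse (X n)) < e" if mn: "m \<ge> max M N" "n \<ge> max M N" for m n
  proof -
    have bm: "rat_pabs p (X m) > b" and bn: "rat_pabs p (X n) > b" using M mn by auto
    hence "X m \<noteq> 0" "X n \<noteq> 0" using b by (auto simp: rat_pabs_0[OF p])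
    hence "rat_pabs p (inverse (X m) - inverse (X n))
        = inverse (rat_pabs p (X m)) * rat_pabs p (X m - X n) * inverse (rat_pabs p (X n))"
      by (rule rat_pabs_inverse_diff)
    also have "\<dots> \<le> inverse b * rat_pabs p (X m - X n) * inverse b"
      using bm bn b rat_pabs_nonneg[OF p]
      by (intro mult_mono mult_nonneg_nonneg le_imp_inverse_le) auto
    also have "\<dots> < inverse b * (e * b * b) * inverse b"
      using b N[of m n] mn by (intro mult_strict_right_mono mult_strict_left_mono) auto
    also have "\<dots> = e" using b by simp
    finally show ?thesis .
  qed
  thus "\<exists>N. \<forall>m\<ge>N. \<forall>n\<ge>N. rat_pabs p (inverse (X m) - inverse (X n)) < e" by blast
qed

lemma pvanishes_inverse_diff:
  assumes X: "pcauchy p X" "\<not> pvanishes p X" and Y: "pcauchy p Y" "\<not> pvanishes p Y"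
    and XY: "pvanishes p (\<lambda>n. X n - Y n)"
  shows "pvanishes p (\<lambda>n. inverse (X n) - inverse (Y n))"
proof -
  obtain a M where a: "a > 0" and M: "\<And>n. n \<ge> M \<Longrightarrow> rat_pabs p (X n) > a"
    using pcauchy_not_vanishes[OF X] by metis
  obtain b N where b: "b > 0" and N: "\<And>n. n \<ge> N \<Longrightarrow> rat_pabs p (Y n) > b"
    using pcauchy_not_vanishes[OF Y] by metis
  have lim: "(\<lambda>n. inverse a * rat_pabs p (X n - Y n) * inverse b) \<longlonglongrightarrow> inverse a * 0 * inverse b"
    using XY unfolding pvanishes_def by (intro tendsto_intros)
  have "rat_pabs p (inverse (X n) - inverse (Y n)) \<le> inverse a * rat_pabs p (X n - Y n) * inverse b"
    if n: "n \<ge> max M N" for n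
  proof -
    have an: "rat_pabs p (X n) > a" and bn: "rat_pabs p (Y n) > b" using M N n by auto
    hence "X n \<noteq> 0" "Y n \<noteq> 0" using a b by (auto simp: rat_pabs_0[OF p])
    hence "rat_pabs p (inverse (X n) - inverse (Y n))
        = inverse (rat_pabs p (X n)) * rat_pabs p (X n - Y n) * inverse (rat_pabs p (Y n))"
      by (rule rat_pabs_inverse_diff)
    also have "\<dots> \<le> inverse a * rat_pabs p (X n - Y n) * inverse b"
      using an bn a b rat_pabs_nonneg[OF p]
      by (intro mult_mono mult_nonneg_nonneg le_imp_inverse_le) auto
    finally show ?thesis .
  qed
  hence ev: "\<forall>\<^sub>F n in sequentially. rat_pabs p (inverse (X n) - inverse (Y n))
      \<le> inverse a * rat_pabs p (X n - Y n) * inverse b"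
    unfolding eventually_sequentially by blast
  show ?thesis unfolding pvanishes_def
    using lim ev rat_pabs_nonneg[OF p]
    by - (rule tendsto_sandwich[of "\<lambda>_. 0" _ _ "\<lambda>n. inverse a * rat_pabs p (X n - Y n) * inverse b"], auto)
qed

lemma pvanishes_cong:
  assumes "pvanishes p (\<lambda>n. X n - Y n)" shows "pvanishes p X \<longleftrightarrow> pvanishes p Y"
  using pvanishes_add[OF assms, of Y] pvanishes_add[OF pvanishes_minus[OF assms], of X] by auto

lemma pvanishes_diff_norm:
  assumes "pcauchy p X" "pcauchy p Y" "pvanishes p (\<lambda>n. X n - Y n)"
  shows "lim (\<lambda>n. rat_pabs p (X n)) = lim (\<lambda>n. rat_pabs p (Y n))"
proof -
  have "(\<lambda>n. rat_pabs p (X n) - rat_pabs p (Y n)) \<longlonglongrightarrow> 0"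
    using assms(3) rat_pabs_abs_diff[OF p] unfolding pvanishes_def
    by - (rule Lim_null_comparison[of "\<lambda>n. rat_pabs p (X n) - rat_pabs p (Y n)"], auto)
  moreover have "(\<lambda>n. rat_pabs p (X n) - rat_pabs p (Y n))
     \<longlonglongrightarrow> lim (\<lambda>n. rat_pabs p (X n)) - lim (\<lambda>n. rat_pabs p (Y n))"
    using pcauchy_norm_tendsto assms by (intro tendsto_diff) auto
  ultimately show ?thesis using LIMSEQ_unique by fastforce
qed

end

text \<open>From here on the prime is carried by a type argument: it is \<open>CARD('p)\<close>.
  \<open>'p pcauchy_seq\<close> is the ring of p-adic Cauchy sequences of rationals, and \<open>'p padic\<close>
  is its quotient by the ideal of null sequences.\<close>

typedef (overloaded) 'p pcauchy_seq = "{X. pcauchy CARD('p::prime_card) X}"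
  using pcauchy_const[OF prime_card] by blast

setup_lifting type_definition_pcauchy_seq

instantiation pcauchy_seq :: (prime_card) comm_ring_1
begin

lift_definition zero_pcauchy_seq :: "'a pcauchy_seq" is "\<lambda>n. 0"
  by (rule pcauchy_const[OF prime_card])

lift_definition one_pcauchy_seq :: "'a pcauchy_seq" is "\<lambda>n. 1"
  by (rule pcauchy_const[OF prime_card])

lift_definition plus_pcauchy_seq :: "'a pcauchy_seq \<Rightarrow> 'a pcauchy_seq \<Rightarrow> 'a pcauchy_seq"
  is "\<lambda>X Y n. X n + Y n"
  by (rule pcauchy_add[OF prime_card])

lift_definition uminus_pcauchy_seq :: "'a pcauchy_seq \<Rightarrow> 'a pcauchy_seq" is "\<lambda>X n. - X n"
  by (rule pcauchy_minus[OF prime_card])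

lift_definition minus_pcauchy_seq :: "'a pcauchy_seq \<Rightarrow> 'a pcauchy_seq \<Rightarrow> 'a pcauchy_seq"
  is "\<lambda>X Y n. X n - Y n"
  subgoal for X Y
    using pcauchy_add[OF prime_card[where ?'a = 'a], of X "\<lambda>n. - Y n"]
      pcauchy_minus[OF prime_card[where ?'a = 'a], of Y] by simp
  done

lift_definition times_pcauchy_seq :: "'a pcauchy_seq \<Rightarrow> 'a pcauchy_seq \<Rightarrow> 'a pcauchy_seq"
  is "\<lambda>X Y n. X n * Y n"
  by (rule pcauchy_mult[OF prime_card])

instance
proof
  fix a b c :: "'a pcauchy_seq"
  show "a * b * c = a * (b * c)" by transfer (simp add: mult.assoc)
  show "a * b = b * a" by transfer (simp add: mult.commute)
  show "1 * a = a" by transfer simp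
  show "a + b + c = a + (b + c)" by transfer (simp add: add.assoc)
  show "a + b = b + a" by transfer (simp add: add.commute)
  show "0 + a = a" by transfer simp
  show "- a + a = 0" by transfer simp
  show "a - b = a + - b" by transfer simp
  show "(a + b) * c = a * c + b * c" by transfer (simp add: distrib_right)
  show "(0::'a pcauchy_seq) \<noteq> 1" by transfer (simp add: fun_eq_iff)
qed

end

lift_definition null_seq :: "'p::prime_card pcauchy_seq \<Rightarrow> bool" is "pvanishes CARD('p)" .

lift_definition seq_norm :: "'p::prime_card pcauchy_seq \<Rightarrow> real"
  is "\<lambda>X. lim (\<lambda>n. rat_pabs CARD('p) (X n))" .

lift_definition seq_inverse :: "'p::prime_card pcauchy_seq \<Rightarrow> 'p pcauchy_seq"
  is "\<lambda>X. if pvanishes CARD('p) X then (\<lambda>n. 0) else (\<lambda>n. inverse (X n))"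
  by (auto simp: pcauchy_const[OF prime_card] pcauchy_inverse[OF prime_card])

lemma null_seq_0 [simp]: "null_seq 0"
  by transfer (rule pvanishes_const_0[OF prime_card])

lemma not_null_seq_1 [simp]: "\<not> null_seq 1"
  by transfer (simp add: pvanishes_def rat_pabs_1[OF prime_card] tendsto_const_iff)

lemma null_seq_add: "null_seq X \<Longrightarrow> null_seq Y \<Longrightarrow> null_seq (X + Y)"
  by transfer (rule pvanishes_add[OF prime_card])

lemma null_seq_minus: "null_seq X \<Longrightarrow> null_seq (- X)"
  by transfer (rule pvanishes_minus[OF prime_card])

lemma null_seq_mult: "null_seq Y \<Longrightarrow> null_seq (X * Y)"
  by transfer (rule pvanishes_mult_left[OF prime_card])

lemma null_seq_cong: "null_seq (X - Y) \<Longrightarrow> null_seq X \<longleftrightarrow> null_seq Y"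
  by transfer (rule pvanishes_cong[OF prime_card])

lemma seq_norm_cong: "null_seq (X - Y) \<Longrightarrow> seq_norm X = seq_norm Y"
  by transfer (rule pvanishes_diff_norm[OF prime_card])

lemma seq_inverse_cong:
  fixes X Y :: "'a::prime_card pcauchy_seq"
  shows "null_seq (X - Y) \<Longrightarrow> null_seq (seq_inverse X - seq_inverse Y)"
proof (transfer, goal_cases)
  fix X Y :: "nat \<Rightarrow> rat"
  assume *: "pcauchy CARD('a) X" "pcauchy CARD('a) Y" "pvanishes CARD('a) (\<lambda>n. X n - Y n)"
  show "pvanishes CARD('a) (\<lambda>n. (if pvanishes CARD('a) X then \<lambda>n. 0 else (\<lambda>n. inverse (X n))) n -
               (if pvanishes CARD('a) Y then \<lambda>n. 0 else (\<lambda>n. inverse (Y n))) n)"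
  proof (cases "pvanishes CARD('a) X")
    case True
    hence "pvanishes CARD('a) Y" using pvanishes_cong[OF prime_card *(3)] by blast
    thus ?thesis using True by (simp add: pvanishes_const_0[OF prime_card])
  next
    case False
    hence Y: "\<not> pvanishes CARD('a) Y" using pvanishes_cong[OF prime_card *(3)] by blast
    show ?thesis using pvanishes_inverse_diff[OF prime_card *(1) False *(2) Y *(3)] False Y
      by simp
  qed
qed

lemma seq_inverse_0: "seq_inverse 0 = 0"
  by transfer (simp add: pvanishes_const_0[OF prime_card])

lemma seq_inverse_mult:
  fixes X :: "'p::prime_card pcauchy_seq"
  assumes "\<not> null_seq X" shows "null_seq (seq_inverse X * X - 1)"
  using assms
proof (transfer, goal_cases)
  fix X :: "nat \<Rightarrow> rat"
  assume X: "pcauchy CARD('p) X" "\<not> pvanishes CARD('p) X"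
  obtain b N where b: "b > 0" "\<And>n. n \<ge> N \<Longrightarrow> rat_pabs CARD('p) (X n) > b"
    using pcauchy_not_vanishes[OF prime_card X] by metis
  have "rat_pabs CARD('p) (inverse (X n) * X n - 1) = 0" if "n \<ge> N" for n
    using b(1) b(2)[OF that] by (cases "X n = 0") (auto simp: rat_pabs_0[OF prime_card])
  hence "pvanishes CARD('p) (\<lambda>n. inverse (X n) * X n - 1)" unfolding pvanishes_def
    by (intro tendsto_eventually) (auto simp: eventually_sequentially)
  thus "pvanishes CARD('p) (\<lambda>n. (if pvanishes CARD('p) X then \<lambda>n. 0 else (\<lambda>n. inverse (X n))) n * X n - 1)"
    using X by simp
qed

definition padic_rel :: "'p::prime_card pcauchy_seq \<Rightarrow> 'p pcauchy_seq \<Rightarrow> bool" where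
  "padic_rel X Y \<longleftrightarrow> null_seq (X - Y)"

lemma equivp_padic_rel: "equivp (padic_rel :: 'a::prime_card pcauchy_seq \<Rightarrow> _)"
  (is "equivp ?R")
proof (rule equivpI)
  show "reflp ?R" by (simp add: reflp_def padic_rel_def)
  show "symp ?R"
  proof (rule sympI)
    fix X Y :: "'a pcauchy_seq" assume "padic_rel X Y"
    thus "padic_rel Y X" using null_seq_minus[of "X - Y"] by (simp add: padic_rel_def)
  qed
  show "transp ?R"
  proof (rule transpI)
    fix X Y Z :: "'a pcauchy_seq" assume "padic_rel X Y" "padic_rel Y Z"
    thus "padic_rel X Z" using null_seq_add[of "X - Y" "Y - Z"] by (simp add: padic_rel_def)
  qed
qed

quotient_type (overloaded) 'p padic = "'p::prime_card pcauchy_seq" / padic_rel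
  by (rule equivp_padic_rel)

instantiation padic :: (prime_card) field
begin

lift_definition zero_padic :: "'a padic" is 0 .

lift_definition one_padic :: "'a padic" is 1 .

lift_definition plus_padic :: "'a padic \<Rightarrow> 'a padic \<Rightarrow> 'a padic" is "(+)"
  subgoal for X X' Y Y'
    using null_seq_add[of "X - X'" "Y - Y'"] by (simp add: padic_rel_def algebra_simps)
  done

lift_definition uminus_padic :: "'a padic \<Rightarrow> 'a padic" is uminus
  subgoal for X X' using null_seq_minus[of "X - X'"] by (simp add: padic_rel_def)
  done

lift_definition minus_padic :: "'a padic \<Rightarrow> 'a padic \<Rightarrow> 'a padic" is "(-)"
  subgoal for X X' Y Y'
    using null_seq_add[of "X - X'" "- (Y - Y')"] null_seq_minus[of "Y - Y'"]
    by (simp add: padic_rel_def algebra_simps)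
  done

lift_definition times_padic :: "'a padic \<Rightarrow> 'a padic \<Rightarrow> 'a padic" is "(*)"
  subgoal for X X' Y Y'
    using null_seq_add[of "X * (Y - Y')" "Y' * (X - X')"]
      null_seq_mult[of "Y - Y'" X] null_seq_mult[of "X - X'" Y']
    by (simp add: padic_rel_def algebra_simps)
  done

lift_definition inverse_padic :: "'a padic \<Rightarrow> 'a padic" is seq_inverse
  by (simp add: padic_rel_def seq_inverse_cong)

definition "x div y = x * inverse y" for x y :: "'a padic"

instance
proof
  fix a b c :: "'a padic"
  show "a * b * c = a * (b * c)" by transfer (simp add: padic_rel_def algebra_simps)
  show "a * b = b * a" by transfer (simp add: padic_rel_def algebra_simps)
  show "1 * a = a" by transfer (simp add: padic_rel_def)
  show "a + b + c = a + (b + c)" by transfer (simp add: padic_rel_def algebra_simps)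
  show "a + b = b + a" by transfer (simp add: padic_rel_def algebra_simps)
  show "0 + a = a" by transfer (simp add: padic_rel_def)
  show "- a + a = 0" by transfer (simp add: padic_rel_def)
  show "a - b = a + - b" by transfer (simp add: padic_rel_def)
  show "(a + b) * c = a * c + b * c" by transfer (simp add: padic_rel_def algebra_simps)
  show "(0::'a padic) \<noteq> 1" by transfer (use null_seq_minus[of "-1"] in \<open>auto simp: padic_rel_def\<close>)
  show "a \<noteq> 0 \<Longrightarrow> inverse a * a = 1" by transfer (simp add: padic_rel_def seq_inverse_mult)
  show "a div b = a * inverse b" by (rule divide_padic_def)
  show "inverse (0::'a padic) = 0" by transfer (simp add: padic_rel_def seq_inverse_0)
qed

end

lemma of_nat_padic: "of_nat n = abs_padic (of_nat n)"
  by (induction n) (simp_all add: zero_padic_def one_padic_def plus_padic.abs_eq)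

lift_definition rat_seq :: "rat \<Rightarrow> 'p::prime_card pcauchy_seq" is "\<lambda>r n. r"
  by (rule pcauchy_const[OF prime_card])

lemma rat_seq_of_nat: "rat_seq (of_nat n) = of_nat n"
proof (induction n)
  case 0 show ?case by simp (transfer, simp)
next
  case (Suc n)
  have "rat_seq (of_nat (Suc n)) = (1 :: 'a pcauchy_seq) + rat_seq (of_nat n)"
    by transfer simp
  thus ?case using Suc by simp
qed

lemma null_seq_rat_seq: "null_seq (rat_seq r :: 'p::prime_card pcauchy_seq) \<longleftrightarrow> r = 0"
  by transfer (use rat_pabs_pos[OF prime_card[where ?'a = 'p]] in
      \<open>force simp: pvanishes_def tendsto_const_iff rat_pabs_0[OF prime_card]\<close>)

instance padic :: (prime_card) field_char_0
proof
  show "inj (of_nat :: nat \<Rightarrow> 'a padic)"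
  proof (rule injI)
    fix m n :: nat assume "(of_nat m :: 'a padic) = of_nat n"
    hence "null_seq (of_nat m - of_nat n :: 'a pcauchy_seq)"
      by (simp add: of_nat_padic padic.abs_eq_iff padic_rel_def)
    also have "of_nat m - of_nat n = (rat_seq (of_nat m - of_nat n) :: 'a pcauchy_seq)"
      unfolding rat_seq_of_nat[symmetric] by transfer simp
    finally show "m = n" by (simp add: null_seq_rat_seq)
  qed
qed


section \<open>Absolute value and topology\<close>

lemma seq_norm_tendsto:
  fixes X :: "'p::prime_card pcauchy_seq"
  shows "(\<lambda>n. rat_pabs CARD('p) (Rep_pcauchy_seq X n)) \<longlonglongrightarrow> seq_norm X"
  using Rep_pcauchy_seq[of X] pcauchy_norm_tendsto[OF prime_card]
  by (simp add: seq_norm.rep_eq)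

lemma seq_norm_0_iff: "seq_norm X = 0 \<longleftrightarrow> null_seq X"
  using seq_norm_tendsto[of X] LIMSEQ_unique by (auto simp: null_seq.rep_eq pvanishes_def)

lemma seq_norm_nonneg: "seq_norm X \<ge> 0"
  using seq_norm_tendsto[of X] by (rule LIMSEQ_le_const) (simp add: rat_pabs_nonneg[OF prime_card])

lemma seq_norm_mult: "seq_norm (X * Y) = seq_norm X * seq_norm Y"
  using tendsto_mult[OF seq_norm_tendsto[of X] seq_norm_tendsto[of Y]] seq_norm_tendsto[of "X * Y"]
    LIMSEQ_unique by (simp add: times_pcauchy_seq.rep_eq rat_pabs_mult[OF prime_card]) blast

lemma seq_norm_minus: "seq_norm (- X) = seq_norm X"
  by (simp add: seq_norm.rep_eq uminus_pcauchy_seq.rep_eq rat_pabs_minus[OF prime_card])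

lemma seq_norm_add: "seq_norm (X + Y) \<le> max (seq_norm X) (seq_norm Y)"
  using seq_norm_tendsto[of "X + Y"] tendsto_max[OF seq_norm_tendsto[of X] seq_norm_tendsto[of Y]]
  by (rule LIMSEQ_le) (simp add: plus_pcauchy_seq.rep_eq rat_pabs_add[OF prime_card])

lemma seq_norm_rat_seq: "seq_norm (rat_seq r :: 'p::prime_card pcauchy_seq) = rat_pabs CARD('p) r"
  by (simp add: seq_norm.rep_eq rat_seq.rep_eq lim_const)

lift_definition padic_abs :: "'p::prime_card padic \<Rightarrow> real" is seq_norm
  by (simp add: padic_rel_def seq_norm_cong)

lemma padic_abs_nonneg: "padic_abs (x :: 'p::prime_card padic) \<ge> 0"
  by transfer (rule seq_norm_nonneg)

lemma padic_abs_0_iff: "padic_abs x = 0 \<longleftrightarrow> x = (0 :: 'p::prime_card padic)"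
  by transfer (simp add: seq_norm_0_iff padic_rel_def)

lemma padic_abs_mult: "padic_abs (x * y) = padic_abs x * padic_abs (y :: 'p::prime_card padic)"
  by transfer (rule seq_norm_mult)

lemma padic_abs_minus: "padic_abs (- x) = padic_abs (x :: 'p::prime_card padic)"
  by transfer (rule seq_norm_minus)

lemma padic_abs_add: "padic_abs (x + y) \<le> max (padic_abs x) (padic_abs (y :: 'p::prime_card padic))"
  by transfer (rule seq_norm_add)

lemma padic_abs_of_nat: "padic_abs (of_nat n :: 'p::prime_card padic) = rat_pabs CARD('p) (of_nat n)"
  by (simp add: of_nat_padic padic_abs.abs_eq seq_norm_rat_seq flip: rat_seq_of_nat)

lemma padic_abs_prime: "padic_abs (of_nat CARD('p) :: 'p::prime_card padic) = 1 / CARD('p)"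
proof -
  have pp: "prime CARD('p)" by (rule prime_card)
  hence "CARD('p) \<noteq> 0" by (metis not_prime_0)
  moreover have "multiplicity (int CARD('p)) (int CARD('p)) = 1"
    using pp by (intro multiplicity_self) auto
  ultimately show ?thesis
    using rat_pabs_frac[OF pp, of "int CARD('p)" 1]
    by (simp add: padic_abs_of_nat power_int_minus divide_inverse)
qed

lemma abs_padic_rat_seq:
  "abs_padic (rat_seq r) = (of_rat r :: 'p::prime_card padic)"
proof -
  obtain a b where ab: "quotient_of r = (a, b)" by (cases "quotient_of r")
  have b: "b > 0" and r: "r = of_int a / of_int b"
    using quotient_of_denom_pos[OF ab] quotient_of_div[OF ab] by auto
  have i: "abs_padic (rat_seq (of_int c)) = (of_int c :: 'p padic)" for c
  proof (cases c)
    case (nonneg n)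
    thus ?thesis by (simp add: of_nat_padic rat_seq_of_nat)
  next
    case (neg n)
    have "rat_seq (of_int c) = - (rat_seq (of_nat (Suc n)) :: 'p pcauchy_seq)"
      unfolding neg by transfer simp
    thus ?thesis unfolding neg rat_seq_of_nat
      by (simp only: uminus_padic.abs_eq[symmetric] of_nat_padic[symmetric] of_int_minus of_int_of_nat_eq)
  qed
  have "rat_seq r * rat_seq (of_int b) = (rat_seq (of_int a) :: 'p pcauchy_seq)"
    unfolding r using b by transfer simp
  hence "abs_padic (rat_seq r) * of_int b = (of_int a :: 'p padic)"
    by (metis times_padic.abs_eq i)
  thus ?thesis using b by (simp add: r of_rat_divide field_simps)
qed

lemma padic_abs_of_rat: "padic_abs (of_rat r :: 'p::prime_card padic) = rat_pabs CARD('p) r"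
  by (simp add: padic_abs.abs_eq seq_norm_rat_seq flip: abs_padic_rat_seq)

lemma rat_dense_padic:
  fixes x :: "'p::prime_card padic"
  assumes "e > 0" obtains r where "padic_abs (x - of_rat r) < e"
proof -
  obtain X where x: "x = abs_padic X" by (metis Quotient_padic Quotient_def)
  have cX: "pcauchy CARD('p) (Rep_pcauchy_seq X)" using Rep_pcauchy_seq[of X] by simp
  then obtain N where N: "\<And>m n. m \<ge> N \<Longrightarrow> n \<ge> N \<Longrightarrow>
      rat_pabs CARD('p) (Rep_pcauchy_seq X m - Rep_pcauchy_seq X n) < e / 2"
    using half_gt_zero[OF assms] unfolding pcauchy_def by meson
  define r where "r = Rep_pcauchy_seq X N"
  have "(\<lambda>n. rat_pabs CARD('p) (Rep_pcauchy_seq (X - rat_seq r) n)) \<longlonglongrightarrow> seq_norm (X - rat_seq r)"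
    by (rule seq_norm_tendsto)
  hence "seq_norm (X - rat_seq r) \<le> e / 2"
    using N by (elim LIMSEQ_le_const2)
      (force simp: r_def minus_pcauchy_seq.rep_eq rat_seq.rep_eq intro!: exI[of _ N] less_imp_le)
  hence "padic_abs (x - of_rat r) < e"
    using assms
    by (simp add: x abs_padic_rat_seq[symmetric] minus_padic.abs_eq padic_abs.abs_eq)
  thus ?thesis by (rule that)
qed

instantiation padic :: (prime_card) metric_space
begin

definition dist_padic :: "'a padic \<Rightarrow> 'a padic \<Rightarrow> real" where
  "dist_padic x y = padic_abs (x - y)"

definition uniformity_padic :: "('a padic \<times> 'a padic) filter" where
  "uniformity_padic = (INF e\<in>{0<..}. principal {(x, y). dist x y < e})"

definition open_padic :: "'a padic set \<Rightarrow> bool" where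
  "open_padic U \<longleftrightarrow> (\<forall>x\<in>U. eventually (\<lambda>(x', y). x' = x \<longrightarrow> y \<in> U) uniformity)"

instance
proof
  fix x y z :: "'a padic" and U :: "'a padic set"
  show "(dist x y = 0) = (x = y)" by (simp add: dist_padic_def padic_abs_0_iff)
  have "padic_abs (x - y) \<le> max (padic_abs (x - z)) (padic_abs (z - y))"
    using padic_abs_add[of "x - z" "z - y"] by simp
  moreover have "padic_abs (z - y) = padic_abs (y - z)" using padic_abs_minus[of "y - z"] by simp
  ultimately show "dist x y \<le> dist x z + dist y z"
    using padic_abs_nonneg[of "x - z"] padic_abs_nonneg[of "y - z"]
    by (simp add: dist_padic_def)
qed (simp_all add: uniformity_padic_def open_padic_def)

end


section \<open>Integers, valuation, residues and the additive character\<close>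

definition padic_integers :: "'p::prime_card padic set" where
  "padic_integers = {x. padic_abs x \<le> 1}"

definition padic_val :: "'p::prime_card padic \<Rightarrow> ereal" where
  "padic_val x = (if x = 0 then \<infinity> else ereal (- log CARD('p) (padic_abs x)))"

text \<open>Reduction modulo p of a p-adic integer, as its representative in \<open>{0..<p}\<close>.\<close>

definition padic_residue :: "'p::prime_card padic \<Rightarrow> int" where
  "padic_residue x =
     (THE a. 0 \<le> a \<and> a < int CARD('p) \<and> (x - of_int a) / of_nat CARD('p) \<in> padic_integers)"

text \<open>The fractional part: the unique element of \<open>\<int>[1/p] \<inter> [0,1)\<close> congruent to \<open>x\<close> modulo
  the p-adic integers.\<close>

definition padic_frac :: "'p::prime_card padic \<Rightarrow> rat" where
  "padic_frac x = (THE r. 0 \<le> r \<and> r < 1 \<and> (\<exists>(a::int) n. r = of_int a / of_nat CARD('p) ^ n)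
                        \<and> x - of_rat r \<in> padic_integers)"

definition padic_char :: "'p::prime_card padic \<Rightarrow> complex" where
  "padic_char x = exp (2 * of_real pi * \<i> * of_rat (padic_frac x))"

lemma prime_card_gt_1: "real CARD('p::prime_card) > 1"
  using prime_gt_1_nat[OF prime_card[where ?'a = 'p]] by simp

lemma padic_abs_diff: "padic_abs (x - y) \<le> max (padic_abs x) (padic_abs (y :: 'p::prime_card padic))"
  using padic_abs_add[of x "- y"] by (simp add: padic_abs_minus)

lemma padic_abs_of_int: "padic_abs (of_int z :: 'p::prime_card padic) = rat_pabs CARD('p) (of_int z)"
  using padic_abs_of_rat[of "of_int z"] by simp

lemma padic_abs_prime_power: "padic_abs (of_nat CARD('p) ^ n :: 'p::prime_card padic) = 1 / CARD('p) ^ n"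
proof (induction n)
  case 0
  have "padic_abs (1 :: 'p padic) = 1"
    using padic_abs_of_int[of 1, where ?'p = 'p] by (simp add: rat_pabs_1[OF prime_card])
  thus ?case by simp
next
  case (Suc n)
  thus ?case by (simp only: power_Suc padic_abs_mult padic_abs_prime) simp
qed

lemma padic_abs_divide_prime_power:
  "padic_abs (x / of_nat CARD('p) ^ n :: 'p::prime_card padic) = padic_abs x * CARD('p) ^ n"
proof -
  have nz: "(of_nat CARD('p) :: 'p padic) \<noteq> 0" using prime_card_gt_1[where ?'p = 'p] by simp
  have "padic_abs x = padic_abs (x / of_nat CARD('p) ^ n * of_nat CARD('p) ^ n)" using nz by simp
  also have "\<dots> = padic_abs (x / of_nat CARD('p) ^ n) * (1 / CARD('p) ^ n)"
    by (simp only: padic_abs_mult padic_abs_prime_power)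
  finally show ?thesis using prime_card_gt_1[where ?'p = 'p] by simp
qed

lemma padic_integer_approx:
  fixes x :: "'p::prime_card padic"
  assumes x: "x \<in> padic_integers"
  shows "\<exists>!a. 0 \<le> a \<and> a < int CARD('p) ^ n \<and> (x - of_int a) / of_nat CARD('p) ^ n \<in> padic_integers"
proof -
  define p where "p = CARD('p)"
  have p: "prime p" unfolding p_def by (rule prime_card)
  have p1: "real p > 1" unfolding p_def by (rule prime_card_gt_1)
  have iff: "(y - of_int a) / of_nat CARD('p) ^ n \<in> padic_integers
      \<longleftrightarrow> padic_abs (y - of_int a) \<le> 1 / real p ^ n" for a and y :: "'p padic"
    using p1 unfolding padic_integers_def mem_Collect_eq padic_abs_divide_prime_power
    unfolding p_def[symmetric] by (simp add: field_simps)
  have "1 / real p ^ n > 0" using p1 by simp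
  then obtain r where r: "padic_abs (x - of_rat r) < 1 / real p ^ n" using rat_dense_padic by blast
  have "1 / real p ^ n \<le> 1" using p1 by simp
  hence "padic_abs (x - of_rat r) \<le> 1" using r by linarith
  hence "padic_abs (of_rat r :: 'p padic) \<le> 1"
    using x padic_abs_diff[of x "x - of_rat r"] by (simp add: padic_integers_def)
  hence r1: "rat_pabs p r \<le> 1" by (simp add: padic_abs_of_rat p_def)
  obtain a b where ab: "quotient_of r = (a, b)" by (cases "quotient_of r")
  have b: "b > 0" and rab: "r = of_int a / of_int b" and cop: "coprime a b"
    using quotient_of_denom_pos[OF ab] quotient_of_div[OF ab] quotient_of_coprime[OF ab] by auto
  have nd: "\<not> int p dvd b"
  proof
    assume d: "int p dvd b"
    have "\<not> int p dvd a"
      using cop d p by (meson coprime_common_divisor not_prime_unit prime_nat_int_transfer)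
    moreover have "rat_pabs p (of_int a) \<le> 1 / real p ^ 1"
    proof -
      have "rat_pabs p (of_int a) = rat_pabs p r * rat_pabs p (of_int b)"
        unfolding rat_pabs_mult[OF p, symmetric] using b by (simp add: rab)
      also have "\<dots> \<le> 1 * rat_pabs p (of_int b)"
        using r1 rat_pabs_nonneg[OF p] by (intro mult_right_mono) auto
      also have "\<dots> \<le> 1 / real p ^ 1" using d rat_pabs_int_le_iff[OF p, of b 1] by simp
      finally show ?thesis .
    qed
    ultimately show False using rat_pabs_int_le_iff[OF p, of a 1] by simp
  qed
  have copn: "coprime b (int p ^ n)"
    using nd p by (metis coprime_commute coprime_power_right_iff prime_imp_coprime prime_nat_int_transfer)
  then obtain c0 where c0: "[b * c0 = 1] (mod int p ^ n)" using cong_solve_coprime_int by blast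
  define c where "c = (a * c0) mod int p ^ n"
  have c: "0 \<le> c" "c < int p ^ n" using p1 by (auto simp: c_def)
  have "[b * c = a * (b * c0)] (mod int p ^ n)"
    unfolding c_def by (metis cong_mod_right cong_refl cong_scalar_left mult.left_commute cong_sym)
  also have "[a * (b * c0) = a * 1] (mod int p ^ n)" using c0 by (rule cong_scalar_left)
  finally have "[b * c = a] (mod int p ^ n)" by simp
  hence dv: "int p ^ n dvd a - b * c" by (metis cong_iff_dvd_diff cong_sym)
  have "\<not> rat_pabs p (of_int b) \<le> 1 / real p ^ 1" using nd rat_pabs_int_le_iff[OF p, of b 1] by simp
  moreover have "rat_pabs p (of_int b) = real p powi (- int (multiplicity (int p) b))"
    using rat_pabs_frac[OF p, of b 1] b by simp
  moreover have "multiplicity (int p) b = 0" using nd by (rule not_dvd_imp_multiplicity_0)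
  ultimately have b1: "rat_pabs p (of_int b) = 1" by simp
  have "rat_pabs p (r - of_int c) = rat_pabs p (r - of_int c) * rat_pabs p (of_int b)"
    using b1 by simp
  also have "\<dots> = rat_pabs p (of_int (a - b * c))"
  proof -
    have "(r - of_int c) * of_int b = of_int (a - b * c)"
      using b by (simp add: rab left_diff_distrib)
    thus ?thesis by (simp only: flip: rat_pabs_mult[OF p])
  qed
  also have "\<dots> \<le> 1 / real p ^ n" using dv rat_pabs_int_le_iff[OF p] by blast
  finally have "padic_abs (of_rat r - of_int c :: 'p padic) \<le> 1 / real p ^ n"
    using padic_abs_of_rat[of "r - of_int c", where ?'p = 'p] by (simp add: of_rat_diff p_def)
  hence cx: "padic_abs (x - of_int c) \<le> 1 / real p ^ n"
    using r padic_abs_add[of "x - of_rat r" "of_rat r - of_int c"] by simp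
  have "a = c" if a: "0 \<le> a" "a < int p ^ n" "padic_abs (x - of_int a) \<le> 1 / real p ^ n" for a
  proof -
    have "padic_abs (of_int (c - a) :: 'p padic) \<le> 1 / real p ^ n"
      using padic_abs_diff[of "x - of_int a" "x - of_int c"] a(3) cx by simp
    hence "int p ^ n dvd c - a"
      unfolding padic_abs_of_int by (simp only: rat_pabs_int_le_iff[OF p] flip: p_def)
    thus "a = c" using a c by (metis cong_iff_dvd_diff cong_less_imp_eq_int)
  qed
  note uniq = this
  show ?thesis unfolding iff unfolding p_def[symmetric]
  proof (rule ex1I[of _ c], goal_cases)
    case 1
    show ?case using c cx by (intro conjI)
  next
    case (2 a)
    thus ?case by (intro uniq) auto
  qed
qed

lemma padic_residue_ex1:
  "x \<in> padic_integers \<Longrightarrow>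
    \<exists>!a. 0 \<le> a \<and> a < int CARD('p) \<and> (x - of_int a) / of_nat CARD('p) \<in> padic_integers"
  for x :: "'p::prime_card padic"
  using padic_integer_approx[of x 1] by simp

lemma padic_frac_ex1:
  fixes x :: "'p::prime_card padic"
  shows "\<exists>!r. 0 \<le> r \<and> r < 1 \<and> (\<exists>(a::int) n. r = of_int a / of_nat CARD('p) ^ n)
           \<and> x - of_rat r \<in> padic_integers"
proof -
  define p where "p = CARD('p)"
  have p: "prime p" unfolding p_def by (rule prime_card)
  have p1: "real p > 1" unfolding p_def by (rule prime_card_gt_1)
  hence p0: "p > 0" by simp
  obtain n where n: "padic_abs x < real p ^ n" using real_arch_pow[OF p1] by blast
  have "x * of_nat p ^ n \<in> padic_integers"
    using n p0 by (simp add: padic_integers_def padic_abs_mult padic_abs_prime_power p_def field_simps)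
  then obtain a where a: "0 \<le> a" "a < int p ^ n"
      "(x * of_nat p ^ n - of_int a) / of_nat p ^ n \<in> padic_integers"
    using padic_integer_approx[of _ n, where ?'p = 'p] unfolding p_def by meson
  define r :: rat where "r = of_int a / of_nat p ^ n"
  have "(x * of_nat p ^ n - of_int a) / of_nat p ^ n = x - of_rat r"
    using p0 by (simp add: r_def of_rat_divide of_rat_power field_simps)
  hence rx: "x - of_rat r \<in> padic_integers" using a by simp
  have "(of_int a :: rat) < of_int (int p ^ n)" using a(2) by (simp only: of_int_less_iff)
  hence r1: "0 \<le> r" "r < 1" using a p0 by (auto simp: r_def field_simps)
  have "r' = r" if r': "0 \<le> r'" "r' < 1" "r' = of_int b / of_nat p ^ m" "x - of_rat r' \<in> padic_integers"
    for r' b m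
  proof -
    define z where "z = b * int p ^ n - a * int p ^ m"
    have z: "r' - r = of_int z / of_int (int p ^ (m + n))"
      using p0 by (simp add: r'(3) r_def z_def field_simps power_add)
    have "padic_abs (of_rat (r' - r) :: 'p padic) \<le> 1"
      using padic_abs_diff[of "x - of_rat r" "x - of_rat r'"] rx r'(4)
      by (simp add: padic_integers_def of_rat_diff)
    hence "rat_pabs p (r' - r) \<le> 1" by (simp add: padic_abs_of_rat p_def)
    moreover have "rat_pabs p (of_int z) = rat_pabs p (r' - r) * rat_pabs p (of_int (int p ^ (m + n)))"
      unfolding rat_pabs_mult[OF p, symmetric] z using p0 by simp
    moreover have "rat_pabs p (of_int (int p ^ (m + n))) \<le> 1 / real p ^ (m + n)"
      using rat_pabs_int_le_iff[OF p, of "int p ^ (m + n)" "m + n"] by (simp only: dvd_refl)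
    ultimately have "rat_pabs p (of_int z) \<le> 1 * (1 / real p ^ (m + n))"
      using rat_pabs_nonneg[OF p] mult_mono by (metis zero_le_one)
    hence "int p ^ (m + n) dvd z" using rat_pabs_int_le_iff[OF p] by simp
    then obtain w where "z = int p ^ (m + n) * w" by blast
    hence "r' - r = of_int w" using z p0 by simp
    moreover have "\<bar>r' - r\<bar> < 1" using r1 r' by linarith
    ultimately have "\<bar>w\<bar> < 1" by (metis of_int_abs of_int_less_1_iff)
    thus "r' = r" using \<open>r' - r = of_int w\<close> by simp
  qed
  note uniq = this
  show ?thesis unfolding p_def[symmetric]
  proof (rule ex1I[of _ r], goal_cases)
    case 1
    show ?case using r1 rx r_def by blast
  next
    case (2 r')
    then obtain b m where "r' = of_int b / of_nat p ^ m" by blast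
    with 2 show ?case by (intro uniq) auto
  qed
qed


section \<open>The quadratic space and the integral\<close>

text \<open>The coordinates \<open>(u\<^sub>1,\<dots>,u\<^sub>m,v\<^sub>1,\<dots>,v\<^sub>m,u\<^sub>0)\<close> are indexed by \<open>'m + 'm + unit\<close>, where
  m = \<open>CARD('m)\<close>.\<close>

type_synonym ('p, 'm) qspace = "'p padic ^ ('m + 'm + unit)"

definition qform :: "('p::prime_card, 'm::finite) qspace \<Rightarrow> 'p padic" where
  "qform x = (\<Sum>i\<in>UNIV. x $ Inl i * x $ Inr (Inl i)) + (x $ Inr (Inr ()))\<^sup>2"

definition qbilin :: "('p::prime_card, 'm::finite) qspace \<Rightarrow> ('p, 'm) qspace \<Rightarrow> 'p padic" where
  "qbilin x y = qform (x + y) - qform x - qform y"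

definition integral_lattice :: "('p::prime_card, 'm::finite) qspace set" where
  "integral_lattice = {x. \<forall>i. x $ i \<in> padic_integers}"

definition prime_power_exactly_divides ::
    "nat \<Rightarrow> ('p::prime_card, 'm::finite) qspace \<Rightarrow> bool" where
  "prime_power_exactly_divides k x \<longleftrightarrow> Min (range (\<lambda>i. padic_val (x $ i))) = ereal (real k)"

text \<open>Since the lattice is compact and open, these conditions determine the measure uniquely.\<close>

definition normalized_haar_measure :: "('p::prime_card, 'm::finite) qspace measure \<Rightarrow> bool" where
  "normalized_haar_measure \<mu> \<longleftrightarrow>
     sets \<mu> = sets borel \<and>
     (\<forall>a. \<forall>A\<in>sets borel. emeasure \<mu> ((+) a ` A) = emeasure \<mu> A) \<and>
     emeasure \<mu> integral_lattice = 1"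

definition J_summand ::
    "('p::prime_card, 'm::finite) qspace measure \<Rightarrow> complex \<Rightarrow> ('p, 'm) qspace \<Rightarrow> nat \<Rightarrow> complex" where
  "J_summand \<mu> s \<eta> r =
     of_nat CARD('p) powr (- of_nat r * s) *
     (LINT x : (*s) (1 / of_nat CARD('p) ^ r) ` integral_lattice | \<mu>.
        padic_char (qbilin \<eta> x) * of_bool (of_nat CARD('p) ^ r * qform x \<in> padic_integers))"

text \<open>\<open>J_integral \<mu> s \<eta>\<close> is \<open>J(s, \<eta>, \<Phi>\<^sub>p)\<close>, where \<open>\<mu>\<close> plays the role of \<open>dx\<close>.\<close>

definition J_integral ::
    "('p::prime_card, 'm::finite) qspace measure \<Rightarrow> complex \<Rightarrow> ('p, 'm) qspace \<Rightarrow> complex" where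
  "J_integral \<mu> s \<eta> = (\<Sum>r. J_summand \<mu> s \<eta> r)"

text \<open>The argument \<open>n\<close> is the exponent with \<open>p\<^sup>n \<parallel> q(\<eta>)\<close>.\<close>

definition chi_eta :: "nat \<Rightarrow> ('p::prime_card, 'm::finite) qspace \<Rightarrow> int" where
  "chi_eta n \<eta> =
     (if even n then Legendre (padic_residue (qform \<eta> / of_nat CARD('p) ^ n)) (int CARD('p)) else 0)"

end

(*
Cutting the dilated lattice p^{-r} V' into cosets of V' turns the r-th summand of J into
p^{-rs} A_r, where A_r is the finite sum of exp(2 pi i (eta, y) / p^r) over the y modulo p^r with
p^r | q(y), and eta may be replaced by an integer vector close to it.  Detect p^r | q(y) by
additive characters t modulo p^r and write t = p^i t' with t' a unit modulo p^(r-i).  The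
hyperbolic planes are summed directly; on the remaining line the substitution w -> t'^{-1}(w - w_0)
replaces t' by its inverse in front of w^2 - q(eta) / p^{2i}, so that no Gauss sum has to be
evaluated: summing over t' just counts square roots of q(eta) / p^{2i} modulo p^(r-i) and p^(r-i-1).
Hence, with X = p^(m-s),
   J = sum_{i <= k} (p^m X)^i F_{nu - 2i}(X),   nu = 2k + k',
where F_n is the generating function of the first differences of the numbers of square roots
modulo p^j of an integer of valuation n.  It satisfies F_{n+2} = 1 - X^2 + p X^2 F_n, which gives
(1 - c X) F_n = (1 - X^2) T_l for l = n div 2 with T_0 = 1 and T_{l+1} = 1 - c X + p X^2 T_l.
So Q = sum_{i <= k} (p^m X)^i T_{L-i}, and the functional equation of Q is that of each T_l.
*)

theory Submission
  imports Defs
begin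

section \<open>Exponential sums\<close>

text \<open>The series for J is a polynomial in X, so it converges for every s and only the quotient
  form needs care. The identity (1 - c X) J = (1 - X^2) Q is proved without denominators; where 1 -
  c X vanishes, the quotient is recovered as a limit. Inverting t' pays off because, with s the
  inverse of t', the planes contribute the phase -s a' b' and the line s (w^2 - c'^2), together s
  (w^2 - q(eta) / p^(2i)). Here s enters linearly, and its sum over units is a Ramanujan sum. Powers
  of p: put N = p^r, K = p^i, M = p^(r-i). Each of the m planes gives N K, the line gives K, the sum
  over units gives M. The product M K cancels the 1 / N of the detection; N^m turns p^(-rs) into
  X^r, and K^m is the p^(mi) in Q. The approximating integer vector depends on r: it must agree with
  eta modulo p^r, and also modulo p^(nu+1), so that its value of q has the valuation of q(eta) and a
  unit part with the same Legendre symbol.\<close>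

definition int_char :: "int \<Rightarrow> int \<Rightarrow> complex" where
  "int_char N x = cis (2 * pi * of_int x / of_int N)"

lemma int_char_0 [simp]: "int_char N 0 = 1"
  by (simp add: int_char_def)

lemma int_char_add: "int_char N (x + y) = int_char N x * int_char N y"
  by (simp add: int_char_def cis_mult add_divide_distrib distrib_left)

lemma int_char_mult_cancel [simp]:
  "c \<noteq> 0 \<Longrightarrow> int_char (N * c) (x * c) = int_char N x" "c \<noteq> 0 \<Longrightarrow> int_char (N * c) (c * x) = int_char N x"
  by (simp_all add: int_char_def mult_ac)

lemma int_char_eq_1_iff:
  assumes "N \<noteq> 0"
  shows "int_char N x = 1 \<longleftrightarrow> N dvd x"
proof
  assume "int_char N x = 1"
  hence "exp (\<i> * of_real (2 * pi * of_int x / of_int N)) = 1"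
    by (simp add: int_char_def cis_conv_exp)
  then obtain n :: int where "2 * pi * of_int x / of_int N = of_int (2 * n) * pi"
    unfolding exp_eq_1 by auto
  hence "real_of_int x = of_int (n * N)" using assms by (simp add: field_simps)
  hence "x = n * N" by (simp only: of_int_eq_iff)
  thus "N dvd x" by simp
next
  assume "N dvd x"
  then obtain n where "x = N * n" by blast
  thus "int_char N x = 1" using assms cis_multiple_2pi[of "of_int n"] by (simp add: int_char_def mult_ac)
qed

lemma int_char_cong:
  assumes "[x = y] (mod N)" "N \<noteq> 0"
  shows "int_char N x = int_char N y"
proof -
  have "int_char N x = int_char N (y + (x - y))" by simp
  also have "\<dots> = int_char N y"
    unfolding int_char_add using assms int_char_eq_1_iff[of N "x - y"] by (simp add: cong_iff_dvd_diff)
  finally show ?thesis .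
qed

lemma int_char_sum: "int_char N (\<Sum>i\<in>A. f i) = (\<Prod>i\<in>A. int_char N (f i))"
  by (induction A rule: infinite_finite_induct) (simp_all add: int_char_add)

section \<open>Sums over residue systems, orthogonality, and the sums of a plane and of the
  line\<close>

lemma sum_residues_shift:
  fixes f :: "int \<Rightarrow> 'a::comm_monoid_add"
  assumes N: "N > 0" and f: "\<And>x. f (x mod N) = f x"
  shows "(\<Sum>z\<in>{0..<N}. f (z + a)) = (\<Sum>z\<in>{0..<N}. f z)"
  using N f[of "_ + a"]
  by (intro sum.reindex_bij_witness[of _ "\<lambda>z. (z - a) mod N" "\<lambda>z. (z + a) mod N"])
    (auto simp: mod_simps)

lemma sum_residues_mult:
  fixes f :: "int \<Rightarrow> 'a::comm_monoid_add"
  assumes N: "N > 0" and f: "\<And>x. f (x mod N) = f x" and st: "[s * t = 1] (mod N)"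
  shows "(\<Sum>z\<in>{0..<N}. f (s * z)) = (\<Sum>z\<in>{0..<N}. f z)"
proof -
  have 1: "(s * (t * z)) mod N = z mod N" "(t * (s * z)) mod N = z mod N" for z
    using cong_scalar_right[OF st, of z] by (simp_all add: cong_def mult_ac)
  show ?thesis
    using N f[of "s * _"] 1
    by (intro sum.reindex_bij_witness[of _ "\<lambda>z. (t * z) mod N" "\<lambda>z. (s * z) mod N"])
      (auto simp: mod_simps)
qed

lemma sum_residues_split:
  fixes f :: "int \<Rightarrow> 'a::comm_monoid_add"
  assumes "M > 0"
  shows "(\<Sum>u\<in>{0..<M * K}. f u) = (\<Sum>u\<in>{0..<M}. \<Sum>z\<in>{0..<K}. f (u + M * z))"
  unfolding sum.cartesian_product
proof (rule sum.reindex_bij_witness[of _ "\<lambda>(u,z). u + M * z" "\<lambda>u. (u mod M, u div M)"], goal_cases)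
  case (2 u)
  have "u div M < K"
  proof (rule ccontr)
    assume "\<not> u div M < K"
    hence "M * K \<le> M * (u div M)" using assms by (intro mult_left_mono) auto
    also have "\<dots> = u - u mod M" by (rule minus_mod_eq_mult_div[symmetric])
    finally show False using 2 pos_mod_sign[OF assms, of u] by simp
  qed
  thus ?case using assms 2 by (simp add: pos_imp_zdiv_nonneg_iff)
next
  case (4 b)
  obtain u z where b: "b = (u, z)" by force
  have "M * (z + 1) \<le> M * K" using 4 assms b by (intro mult_left_mono) auto
  thus ?case using 4 b assms by (auto simp: algebra_simps)
qed (use assms in auto)

text \<open>Orthogonality: shifting z by 1 multiplies the sum by \<open>int_char N b\<close>, so the
  sum vanishes unless this factor is 1.\<close>

lemma sum_int_char:
  assumes "N > 0"
  shows "(\<Sum>z\<in>{0..<N}. int_char N (b * z)) = of_bool (N dvd b) * of_int N"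
proof (cases "N dvd b")
  case True
  hence "int_char N (b * z) = 1" for z using assms by (simp add: int_char_eq_1_iff)
  thus ?thesis using True assms by simp
next
  case False
  let ?S = "\<Sum>z\<in>{0..<N}. int_char N (b * z)"
  have "int_char N (b * (x mod N)) = int_char N (b * x)" for x
    using assms by (intro int_char_cong) (auto simp: cong_def mod_simps)
  hence "(\<Sum>z\<in>{0..<N}. int_char N (b * (z + 1))) = ?S"
    using assms by (intro sum_residues_shift)
  hence "?S * int_char N b = ?S"
    by (simp add: distrib_left int_char_add sum_distrib_right)
  moreover have "int_char N b \<noteq> 1" using False assms int_char_eq_1_iff by auto
  ultimately have "?S = 0" by (metis mult_cancel_left2)
  thus ?thesis using False by simp
qed

text \<open>The phase is linear in v, so the sum over v forces M K to divide K t u + a. This needs K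
  to divide a and fixes u modulo M only; the remaining freedom u + M z is a character sum modulo K,
  which forces K to divide b.\<close>

lemma hyperbolic_plane_sum:
  fixes M K :: int
  assumes M: "M > 0" and K: "K > 0" and ts: "[t * s = 1] (mod M)"
  shows "(\<Sum>u\<in>{0..<M*K}. \<Sum>v\<in>{0..<M*K}. int_char (M*K) (K * t * (u * v) + (a * v + b * u)))
    = of_bool (K dvd a \<and> K dvd b) * (of_int (M * K) * of_int K * int_char M (- (s * ((a div K) * (b div K)))))"
proof -
  let ?N = "M * K"
  have N: "?N > 0" using M K by simp
  have "(\<Sum>u\<in>{0..<?N}. \<Sum>v\<in>{0..<?N}. int_char ?N (K * t * (u * v) + (a * v + b * u)))
      = (\<Sum>u\<in>{0..<?N}. \<Sum>v\<in>{0..<?N}. int_char ?N (b * u) * int_char ?N ((K * t * u + a) * v))"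
    by (intro sum.cong) (auto simp: algebra_simps simp flip: int_char_add)
  also have "\<dots> = (\<Sum>u\<in>{0..<?N}. int_char ?N (b * u) * (of_bool (?N dvd K * t * u + a) * of_int ?N))"
    unfolding sum_distrib_left[symmetric] sum_int_char[OF N] ..
  finally have *: "(\<Sum>u\<in>{0..<?N}. \<Sum>v\<in>{0..<?N}. int_char ?N (K * t * (u * v) + (a * v + b * u))) = \<dots>" .
  show ?thesis
  proof (cases "K dvd a")
    case False
    have "\<not> ?N dvd K * t * u + a" for u
    proof
      assume "?N dvd K * t * u + a"
      hence "K dvd K * (t * u) + a" by (metis dvd_mult_right mult.assoc)
      thus False using False dvd_add_right_iff[of K "K * (t * u)" a] by simp
    qed
    thus ?thesis unfolding * using False by simp
  next
    case True
    then obtain a' where a: "a = K * a'" by blast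
    \<comment> \<open>The solution of t u + a' = 0 modulo M, as s is the inverse of t.\<close>
    define u0 where "u0 = (- (s * a')) mod M"
    have iff: "?N dvd K * t * u + a \<longleftrightarrow> M dvd t * u + a'" for u
      using K dvd_mult_cancel_left[of K M "t * u + a'"] by (simp add: a algebra_simps)
    have iff2: "M dvd t * u + a' \<longleftrightarrow> u = u0" if "u \<in> {0..<M}" for u
    proof -
      have st: "M dvd t * s - 1" using ts by (simp add: cong_iff_dvd_diff)
      have "M dvd t * u + a' \<longleftrightarrow> M dvd u + s * a'"
      proof
        assume "M dvd t * u + a'"
        hence "M dvd s * (t * u + a') - (t * s - 1) * u" using st by (intro dvd_diff dvd_mult2[OF st]) simp_all
        thus "M dvd u + s * a'" by (simp add: algebra_simps)
      next
        assume "M dvd u + s * a'"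
        hence "M dvd t * (u + s * a') - (t * s - 1) * a'" using st by (intro dvd_diff dvd_mult2[OF st]) simp_all
        thus "M dvd t * u + a'" by (simp add: algebra_simps)
      qed
      also have "\<dots> \<longleftrightarrow> [u = - (s * a')] (mod M)" by (simp add: cong_iff_dvd_diff)
      also have "\<dots> \<longleftrightarrow> u = u0" using that by (auto simp: cong_def u0_def)
      finally show ?thesis .
    qed
    have u0: "u0 \<in> {0..<M}" using M by (simp add: u0_def)
    have "(\<Sum>u\<in>{0..<?N}. int_char ?N (b * u) * (of_bool (?N dvd K * t * u + a) * of_int ?N))
       = (\<Sum>u\<in>{0..<M}. \<Sum>z\<in>{0..<K}. int_char ?N (b * (u + M * z)) * (of_bool (M dvd t * (u + M * z) + a') * of_int ?N))"
      unfolding iff using M by (rule sum_residues_split)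
    also have "\<dots> = (\<Sum>u\<in>{0..<M}. \<Sum>z\<in>{0..<K}. of_bool (u = u0) * of_int ?N * int_char ?N (b * u) * int_char K (b * z))"
    proof (intro sum.cong refl, goal_cases)
      case (1 u z)
      have "M dvd t * (u + M * z) + a' \<longleftrightarrow> M dvd M * (t * z) + (t * u + a')" by (simp add: algebra_simps)
      also have "\<dots> \<longleftrightarrow> u = u0" using dvd_add_right_iff[of M "M * (t * z)" "t * u + a'"] iff2 1 by simp
      finally have "M dvd t * (u + M * z) + a' \<longleftrightarrow> u = u0" .
      moreover have "int_char ?N (b * (u + M * z)) = int_char ?N (b * u) * int_char K (b * z)"
        using int_char_mult_cancel(1)[of M K "b * z"] M by (simp add: algebra_simps int_char_add)
      ultimately show ?case by simp
    qed
    also have "\<dots> = (\<Sum>u\<in>{0..<M}. of_bool (u = u0) * (of_int ?N * int_char ?N (b * u) * (of_bool (K dvd b) * of_int K)))"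
      unfolding sum_distrib_left[symmetric] sum_int_char[OF K] by (simp add: mult_ac)
    also have "\<dots> = of_int ?N * int_char ?N (b * u0) * (of_bool (K dvd b) * of_int K)"
      using u0 by (simp add: of_bool_def if_distrib[of "\<lambda>x. x * _"] sum.delta cong: if_cong)
    also have "\<dots> = of_bool (K dvd a \<and> K dvd b) * (of_int ?N * of_int K * int_char M (- (s * ((a div K) * (b div K)))))"
    proof (cases "K dvd b")
      case True
      then obtain b' where b: "b = K * b'" by blast
      have "int_char ?N (b * u0) = int_char M (b' * u0)"
        using int_char_mult_cancel(2)[of K M "b' * u0"] K by (simp add: b mult_ac)
      also have "\<dots> = int_char M (- (s * ((a div K) * (b div K))))"
        using M K by (intro int_char_cong) (auto simp: a b u0_def cong_def mod_simps mult_ac)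
      finally show ?thesis using True \<open>K dvd a\<close> by (simp add: mult_ac)
    qed simp
    finally show ?thesis unfolding * .
  qed
qed

text \<open>The quadratic part depends only on w modulo M, so the higher digits of w see just the
  character 2 c z modulo K. They force K to divide 2 c, hence c, because K is odd.\<close>

lemma quadratic_line_sum:
  fixes M K :: int
  assumes M: "M > 0" and K: "K > 0" "odd K" and ts: "[t * s = 1] (mod M)"
  shows "(\<Sum>w\<in>{0..<M*K}. int_char (M*K) (K * t * w^2 + 2 * c * w))
    = of_bool (K dvd c) * (of_int K * (\<Sum>w\<in>{0..<M}. int_char M (s * (w^2 - (c div K)^2))))"
proof -
  let ?N = "M * K"
  have N: "?N > 0" using M K by simp
  have "(\<Sum>w\<in>{0..<?N}. int_char ?N (K * t * w^2 + 2 * c * w))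
      = (\<Sum>w\<in>{0..<M}. \<Sum>z\<in>{0..<K}. int_char ?N (K * t * (w + M * z)^2 + 2 * c * (w + M * z)))"
    using M by (rule sum_residues_split)
  also have "\<dots> = (\<Sum>w\<in>{0..<M}. \<Sum>z\<in>{0..<K}. int_char ?N (K * t * w^2 + 2 * c * w) * int_char K (2 * c * z))"
  proof (intro sum.cong refl, goal_cases)
    case (1 w z)
    have "int_char ?N (K * t * (w + M * z)^2 + 2 * c * (w + M * z))
       = int_char ?N ((K * t * w^2 + 2 * c * w + 2 * c * z * M) + ?N * (t * (2 * w * z + M * z^2)))"
      by (simp add: algebra_simps power2_eq_square)
    also have "\<dots> = int_char ?N (K * t * w^2 + 2 * c * w + 2 * c * z * M)"
      using N by (intro int_char_cong) (auto simp: cong_iff_dvd_diff)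
    also have "\<dots> = int_char ?N (K * t * w^2 + 2 * c * w) * int_char K (2 * c * z)"
      using int_char_mult_cancel(1)[of M K "2 * c * z"] M by (simp add: int_char_add mult.commute[of M])
    finally show ?case .
  qed
  also have "\<dots> = (\<Sum>w\<in>{0..<M}. int_char ?N (K * t * w^2 + 2 * c * w)) * (of_bool (K dvd 2 * c) * of_int K)"
    unfolding sum_distrib_left[symmetric] sum_int_char[OF K(1)] sum_distrib_right[symmetric] ..
  also have "K dvd 2 * c \<longleftrightarrow> K dvd c"
    using K by (simp add: coprime_dvd_mult_right_iff)
  also have "(\<Sum>w\<in>{0..<M}. int_char ?N (K * t * w^2 + 2 * c * w)) * (of_bool (K dvd c) * of_int K)
      = of_bool (K dvd c) * (of_int K * (\<Sum>w\<in>{0..<M}. int_char M (s * (w^2 - (c div K)^2))))"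
  proof (cases "K dvd c")
    case True
    then obtain d where c: "c = K * d" by blast
    let ?f = "\<lambda>w. int_char M (t * w^2 + 2 * d * w)"
    have per: "?f (x mod M) = ?f x" for x
    proof (rule int_char_cong)
      show "[t * (x mod M)^2 + 2 * d * (x mod M) = t * x^2 + 2 * d * x] (mod M)"
        by (intro cong_add cong_mult cong_pow) auto
    qed (use M in auto)
    have "(\<Sum>w\<in>{0..<M}. int_char ?N (K * t * w^2 + 2 * c * w)) = (\<Sum>w\<in>{0..<M}. ?f w)"
    proof (intro sum.cong refl, goal_cases)
      case (1 w)
      show ?case using int_char_mult_cancel(2)[of K M "t * w^2 + 2 * d * w"] K
        by (simp add: c algebra_simps)
    qed
    \<comment> \<open>Modulo M, the scaling w -> s w makes the phase s (w^2 + 2 d w) = s ((w + d)^2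
      - d^2); the shift by -d then removes the linear term.\<close>
    also have "\<dots> = (\<Sum>w\<in>{0..<M}. ?f (s * w))"
      by (rule sum_residues_mult[of M ?f s t, symmetric, OF M per]) (use ts in \<open>simp add: mult.commute\<close>)
    also have "\<dots> = (\<Sum>w\<in>{0..<M}. ?f (s * (w + (- d))))"
    proof (rule sum_residues_shift[of M "\<lambda>w. ?f (s * w)", symmetric, OF M])
      fix x
      have "?f (s * (x mod M)) = ?f ((s * (x mod M)) mod M)" by (rule per[symmetric])
      also have "(s * (x mod M)) mod M = (s * x) mod M" by (simp add: mod_simps)
      also have "?f \<dots> = ?f (s * x)" by (rule per)
      finally show "?f (s * (x mod M)) = ?f (s * x)" .
    qed
    also have "\<dots> = (\<Sum>w\<in>{0..<M}. int_char M (s * (w^2 - d^2)))"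
    proof (intro sum.cong refl int_char_cong, goal_cases)
      case (1 w)
      have "M dvd (t * s - 1) * (s * (w - d)^2)"
        using ts by (simp add: cong_iff_dvd_diff)
      also have "(t * s - 1) * (s * (w - d)^2)
        = (t * (s * (w + - d))\<^sup>2 + 2 * d * (s * (w + - d))) - s * (w\<^sup>2 - d\<^sup>2)"
        by (simp add: algebra_simps power2_eq_square)
      finally show ?case by (simp only: cong_iff_dvd_diff)
    qed (use M in auto)
    finally show ?thesis using K by (simp add: c)
  qed simp
  finally show ?thesis .
qed

section \<open>Unit residues, Ramanujan sums and numbers of square roots\<close>

definition residue_units :: "int \<Rightarrow> int set" where
  "residue_units M = {t \<in> {0..<M}. coprime t M}"

lemma finite_residue_units [simp]: "finite (residue_units M)"
  by (rule finite_subset[of _ "{0..<M}"]) (auto simp: residue_units_def)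

text \<open>With 0 as a unit modulo 1, the residue t = 0 modulo p^r is covered by the term i = r of
  the splitting by valuation.\<close>

lemma residue_units_1 [simp]: "residue_units 1 = {0}"
  by (auto simp: residue_units_def)

lemma sum_prime_power_Suc:
  fixes f :: "int \<Rightarrow> 'a::comm_monoid_add"
  assumes p: "prime p"
  shows "(\<Sum>t\<in>{0..<p ^ Suc r}. f t) = (\<Sum>t\<in>residue_units (p ^ Suc r). f t) + (\<Sum>t\<in>{0..<p ^ r}. f (p * t))"
proof -
  have p0: "p > 0" using p by (rule prime_gt_0_int)
  have iff: "coprime t (p ^ Suc r) \<longleftrightarrow> \<not> p dvd t" for t
    using prime_imp_coprime[OF p, of t] coprime_absorb_left[of p t] not_prime_unit[of p] p
    by (auto simp: coprime_commute[of t] coprime_power_left_iff simp del: power_Suc)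
  have "{0..<p ^ Suc r} = residue_units (p ^ Suc r) \<union> (\<lambda>t. p * t) ` {0..<p ^ r}"
  proof (intro equalityI subsetI)
    fix t assume t: "t \<in> {0..<p ^ Suc r}"
    show "t \<in> residue_units (p ^ Suc r) \<union> (\<lambda>t. p * t) ` {0..<p ^ r}"
    proof (cases "p dvd t")
      case True
      then obtain u where u: "t = p * u" by blast
      hence "u \<in> {0..<p ^ r}" using t p0 by (auto simp: zero_le_mult_iff)
      thus ?thesis using u by blast
    next
      case False
      thus ?thesis using t unfolding residue_units_def iff by simp
    qed
  qed (use p0 in \<open>auto simp: residue_units_def\<close>)
  moreover have "residue_units (p ^ Suc r) \<inter> (\<lambda>t. p * t) ` {0..<p ^ r} = {}"
    unfolding residue_units_def iff by auto
  ultimately have "(\<Sum>t\<in>{0..<p ^ Suc r}. f t)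
      = (\<Sum>t\<in>residue_units (p ^ Suc r). f t) + (\<Sum>t\<in>(\<lambda>t. p * t) ` {0..<p ^ r}. f t)"
    by (simp only: sum.union_disjoint finite_residue_units finite_imageI finite_atLeastLessThan_int)
  also have "(\<Sum>t\<in>(\<lambda>t. p * t) ` {0..<p ^ r}. f t) = (\<Sum>t\<in>{0..<p ^ r}. f (p * t))"
    using p0 by (subst sum.reindex) (auto simp: inj_on_def)
  finally show ?thesis .
qed

lemma sum_by_prime_valuation:
  fixes f :: "int \<Rightarrow> 'a::comm_monoid_add"
  assumes p: "prime p"
  shows "(\<Sum>t\<in>{0..<p ^ r}. f t) = (\<Sum>i\<le>r. \<Sum>t\<in>residue_units (p ^ (r - i)). f (p ^ i * t))"
proof (induction r arbitrary: f)
  case (Suc r)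
  show ?case
    unfolding sum_prime_power_Suc[OF p] Suc sum.atMost_Suc_shift by (simp add: mult_ac)
next
  case 0
  have "{0..<1::int} = {0}" by auto
  thus ?case by simp
qed

text \<open>Inversion is an involution of the units. The plane and line sums for t produce phases in
  the inverse of t; this lets the inverse itself be the summation variable.\<close>

lemma sum_units_modular_inverse:
  fixes f :: "int \<Rightarrow> 'a::comm_monoid_add"
  assumes M: "M > 0"
  shows "(\<Sum>t\<in>residue_units M. f (modular_inverse M t)) = (\<Sum>t\<in>residue_units M. f t)"
proof -
  have mem: "modular_inverse M t \<in> residue_units M" if "t \<in> residue_units M" for t
    using that M by (auto simp: residue_units_def modular_inverse_int_nonneg modular_inverse_int_less)
  have inv: "modular_inverse M (modular_inverse M t) = t" if "t \<in> residue_units M" for t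
    using that cong_modular_inverse2[of t M]
    by (intro modular_inverse_int_eqI) (auto simp: residue_units_def)
  show ?thesis
    by (rule sum.reindex_bij_witness[of _ "modular_inverse M" "modular_inverse M"]) (simp_all add: mem inv)
qed

definition sqrt_count :: "int \<Rightarrow> nat \<Rightarrow> int \<Rightarrow> nat" where
  "sqrt_count p j n = card {w \<in> {0..<p ^ j}. p ^ j dvd w^2 - n}"

text \<open>The value 1 at j = 0 amounts to a count 0 before the count 1 modulo p^0; it is also the
  value of the sum over units modulo 1.\<close>

definition sqrt_count_diff :: "int \<Rightarrow> nat \<Rightarrow> int \<Rightarrow> int" where
  "sqrt_count_diff p j n = (if j = 0 then 1 else int (sqrt_count p j n) - int (sqrt_count p (j - 1) n))"

text \<open>The condition depends only on w modulo p^j, and each such class has p representatives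
  below p^(j+1).\<close>

lemma sqrt_count_wide:
  assumes "p > 0"
  shows "int (card {w \<in> {0..<p ^ Suc j}. p ^ j dvd w^2 - n}) = p * int (sqrt_count p j n)"
proof -
  have "int (card {w \<in> {0..<p ^ Suc j}. p ^ j dvd w^2 - n}) = (\<Sum>w\<in>{0..<p ^ Suc j}. of_bool (p ^ j dvd w^2 - n))"
    by (simp add: of_bool_def flip: sum.inter_filter)
  also have "\<dots> = (\<Sum>w\<in>{0..<p ^ j}. \<Sum>z\<in>{0..<p}. of_bool (p ^ j dvd (w + p ^ j * z)^2 - n))"
    unfolding power_Suc2 using assms by (intro sum_residues_split) simp
  also have "\<dots> = (\<Sum>w\<in>{0..<p ^ j}. \<Sum>z\<in>{0..<p}. of_bool (p ^ j dvd w^2 - n))"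
  proof (intro sum.cong refl arg_cong[of _ _ of_bool], goal_cases)
    case (1 w z)
    have eq: "(w + p ^ j * z)^2 - n = p ^ j * (2 * w * z + p ^ j * z^2) + (w^2 - n)"
      by (simp add: algebra_simps power2_eq_square)
    show ?case unfolding eq by (rule dvd_add_right_iff) simp
  qed
  also have "\<dots> = p * (\<Sum>w\<in>{0..<p ^ j}. of_bool (p ^ j dvd w^2 - n))"
    using assms by (simp only: sum_constant sum_distrib_left) simp
  also have "(\<Sum>w\<in>{0..<p ^ j}. of_bool (p ^ j dvd w^2 - n)) = int (sqrt_count p j n)"
    by (simp add: sqrt_count_def of_bool_def flip: sum.inter_filter)
  finally show ?thesis .
qed

text \<open>Removing the multiples of p from a full character sum gives the Ramanujan sum p^j
  [p^j | x] - p^(j-1) [p^(j-1) | x]. Summed over w, the second term counts each root modulo p^(j-1)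
  p times, so both terms carry the factor p^j. For j = 0 both sides are 1.\<close>

lemma sum_units_quadratic:
  assumes p: "prime p"
  shows "(\<Sum>t\<in>residue_units (p ^ j). \<Sum>w\<in>{0..<p ^ j}. int_char (p ^ j) (t * (w^2 - n)))
     = of_int (p ^ j) * of_int (sqrt_count_diff p j n)"
proof (cases j)
  case 0
  have "{0..<1::int} = {0}" by auto
  thus ?thesis by (simp add: 0 sqrt_count_diff_def)
next
  case (Suc i)
  have p0: "p > 0" using p by (rule prime_gt_0_int)
  have pj: "p ^ j > 0" "p ^ i > 0" using p0 by simp_all
  have unit: "(\<Sum>t\<in>residue_units (p ^ j). int_char (p ^ j) (t * x))
      = of_bool (p ^ j dvd x) * of_int (p ^ j) - of_bool (p ^ i dvd x) * of_int (p ^ i)" for x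
  proof -
    have "int_char (p ^ j) (p * t * x) = int_char (p ^ i) (x * t)" for t
      using int_char_mult_cancel(2)[of p "p ^ i" "x * t"] p0 by (simp add: Suc mult_ac)
    thus ?thesis
      using sum_prime_power_Suc[OF p, of "\<lambda>t. int_char (p ^ j) (t * x)" i]
        sum_int_char[OF pj(1), of x] sum_int_char[OF pj(2), of x]
      by (simp add: mult.commute[of x] Suc algebra_simps)
  qed
  have cnt: "(\<Sum>w\<in>A. of_bool (P w)) = (of_int (int (card {w \<in> A. P w})) :: complex)"
    if "finite A" for A :: "int set" and P
    using that by (simp add: of_bool_def flip: sum.inter_filter)
  have split: "(\<Sum>w\<in>{0..<p ^ j}. of_bool (p ^ i dvd w^2 - n)) = of_int p * (of_nat (sqrt_count p i n) :: complex)"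
    using sqrt_count_wide[OF p0, of i n] by (simp only: cnt finite_atLeastLessThan_int Suc of_int_mult of_int_of_nat_eq)
  have cnt': "(\<Sum>w\<in>{0..<p ^ j}. of_bool (p ^ j dvd w^2 - n)) = (of_nat (sqrt_count p j n) :: complex)"
    by (simp only: cnt finite_atLeastLessThan_int sqrt_count_def of_int_of_nat_eq)
  have "(\<Sum>t\<in>residue_units (p ^ j). \<Sum>w\<in>{0..<p ^ j}. int_char (p ^ j) (t * (w^2 - n)))
     = (\<Sum>w\<in>{0..<p ^ j}. of_bool (p ^ j dvd w^2 - n) * of_int (p ^ j) - of_bool (p ^ i dvd w^2 - n) * of_int (p ^ i))"
    unfolding unit[symmetric] by (rule sum.swap)
  also have "\<dots> = of_nat (sqrt_count p j n) * of_int (p ^ j) - of_int p * of_nat (sqrt_count p i n) * of_int (p ^ i)"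
    unfolding sum_subtractf sum_distrib_right[symmetric] cnt' split ..
  also have "\<dots> = of_int (p ^ j) * of_int (sqrt_count_diff p j n)"
    by (simp add: sqrt_count_diff_def Suc algebra_simps)
  finally show ?thesis .
qed

text \<open>Here (a, b, c) stands for eta. The pair \<open>g j\<close> holds the two coordinates of
  the j-th hyperbolic plane, so that the sum over \<open>g\<close> factors into one double sum per
  plane; the 2 comes from polarizing w^2.\<close>

definition quadric_char_sum ::
    "int \<Rightarrow> nat \<Rightarrow> ('m::finite \<Rightarrow> int) \<Rightarrow> ('m \<Rightarrow> int) \<Rightarrow> int \<Rightarrow> complex" where
  "quadric_char_sum p r a b c =
     (\<Sum>g\<in>PiE UNIV (\<lambda>_. {0..<p ^ r} \<times> {0..<p ^ r}). \<Sum>w\<in>{0..<p ^ r}.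
        of_bool (p ^ r dvd (\<Sum>j\<in>UNIV. fst (g j) * snd (g j)) + w^2) *
        int_char (p ^ r) ((\<Sum>j\<in>UNIV. a j * snd (g j) + b j * fst (g j)) + 2 * c * w))"

lemma quadric_char_sum_eq:
  fixes a b :: "'m::finite \<Rightarrow> int"
  assumes p: "prime p" and odd: "odd p"
  shows "quadric_char_sum p r a b c = of_int p ^ (r * CARD('m)) *
    (\<Sum>i\<le>r. of_bool ((\<forall>j. p ^ i dvd a j \<and> p ^ i dvd b j) \<and> p ^ i dvd c) * of_int p ^ (i * CARD('m)) *
       of_int (sqrt_count_diff p (r - i) ((\<Sum>j\<in>UNIV. (a j div p ^ i) * (b j div p ^ i)) + (c div p ^ i)^2)))"
proof -
  define N where "N = p ^ r"
  have p0: "p > 0" using p by (rule prime_gt_0_int)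
  have N: "N > 0" using p0 by (simp add: N_def)
  let ?m = "CARD('m)"
  define cond where "cond i \<longleftrightarrow> (\<forall>j. p ^ i dvd a j \<and> p ^ i dvd b j) \<and> p ^ i dvd c" for i
  define n where "n i = (\<Sum>j\<in>UNIV. (a j div p ^ i) * (b j div p ^ i)) + (c div p ^ i)^2" for i
  define G where "G t a b = (\<Sum>u\<in>{0..<N}. \<Sum>v\<in>{0..<N}. int_char N (t * (u * v) + (a * v + b * u)))" for t a b
  define H where "H t = (\<Sum>w\<in>{0..<N}. int_char N (t * w^2 + 2 * c * w))" for t
  have ind: "of_int N * of_bool (N dvd x) = (\<Sum>t\<in>{0..<N}. int_char N (t * x))" for x
    using sum_int_char[OF N, of x] by (simp add: mult.commute)
  \<comment> \<open>The extra N turns the indicator into a plain sum of N characters; it is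
    cancelled at the very end.\<close>
  have "of_int N * quadric_char_sum p r a b c =
     (\<Sum>g\<in>PiE UNIV (\<lambda>_. {0..<N} \<times> {0..<N}). \<Sum>w\<in>{0..<N}.
        (of_int N * of_bool (N dvd (\<Sum>j\<in>UNIV. fst (g j) * snd (g j)) + w^2)) *
        int_char N ((\<Sum>j\<in>UNIV. a j * snd (g j) + b j * fst (g j)) + 2 * c * w))"
    by (simp only: quadric_char_sum_def N_def sum_distrib_left mult.assoc)
  also have "\<dots> = (\<Sum>g\<in>PiE UNIV (\<lambda>_. {0..<N} \<times> {0..<N}). \<Sum>w\<in>{0..<N}. \<Sum>t\<in>{0..<N}.
        (\<Prod>j\<in>UNIV. int_char N (t * (fst (g j) * snd (g j)) + (a j * snd (g j) + b j * fst (g j)))) *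
        int_char N (t * w^2 + 2 * c * w))"
    unfolding ind sum_distrib_right
    by (intro sum.cong refl)
      (simp add: int_char_sum[symmetric] int_char_add[symmetric] sum.distrib sum_distrib_left algebra_simps)
  also have "\<dots> = (\<Sum>g\<in>PiE UNIV (\<lambda>_. {0..<N} \<times> {0..<N}). \<Sum>t\<in>{0..<N}. \<Sum>w\<in>{0..<N}.
        (\<Prod>j\<in>UNIV. int_char N (t * (fst (g j) * snd (g j)) + (a j * snd (g j) + b j * fst (g j)))) *
        int_char N (t * w^2 + 2 * c * w))"
    by (intro sum.cong refl sum.swap)
  also have "\<dots> = (\<Sum>g\<in>PiE UNIV (\<lambda>_. {0..<N} \<times> {0..<N}). \<Sum>t\<in>{0..<N}.
        (\<Prod>j\<in>UNIV. int_char N (t * (fst (g j) * snd (g j)) + (a j * snd (g j) + b j * fst (g j)))) * H t)"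
    by (simp add: sum_distrib_left H_def)
  also have "\<dots> = (\<Sum>t\<in>{0..<N}. (\<Sum>g\<in>PiE UNIV (\<lambda>_. {0..<N} \<times> {0..<N}).
        (\<Prod>j\<in>UNIV. int_char N (t * (fst (g j) * snd (g j)) + (a j * snd (g j) + b j * fst (g j))))) * H t)"
    unfolding sum_distrib_right by (rule sum.swap)
  also have "\<dots> = (\<Sum>t\<in>{0..<N}. (\<Prod>j\<in>UNIV. G t (a j) (b j)) * H t)"
  proof (intro sum.cong refl arg_cong2[of _ _ _ _ "(*)"], goal_cases)
    case (1 t)
    have "(\<Sum>g\<in>PiE UNIV (\<lambda>_. {0..<N} \<times> {0..<N}).
        (\<Prod>j\<in>UNIV. int_char N (t * (fst (g j) * snd (g j)) + (a j * snd (g j) + b j * fst (g j)))))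
       = (\<Prod>j\<in>UNIV. \<Sum>x\<in>{0..<N} \<times> {0..<N}. int_char N (t * (fst x * snd x) + (a j * snd x + b j * fst x)))"
      by (subst prod_sum_PiE) auto
    also have "\<dots> = (\<Prod>j\<in>UNIV. G t (a j) (b j))"
      unfolding G_def sum.cartesian_product by (intro prod.cong sum.cong) auto
    finally show ?case .
  qed
  also have "\<dots> = (\<Sum>i\<le>r. \<Sum>t\<in>residue_units (p ^ (r - i)). (\<Prod>j\<in>UNIV. G (p ^ i * t) (a j) (b j)) * H (p ^ i * t))"
    unfolding N_def by (rule sum_by_prime_valuation[OF p])
  also have "\<dots> = (\<Sum>i\<le>r. of_bool (cond i) * (of_int N ^ ?m * of_int p ^ (i * ?m) * of_int p ^ i) *
      (of_int (p ^ (r - i)) * of_int (sqrt_count_diff p (r - i) (n i))))"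
  proof (intro sum.cong refl, goal_cases)
    case (1 i)
    define M K where "M = p ^ (r - i)" and "K = p ^ i"
    have M: "M > 0" and K: "K > 0" "odd K" using p0 odd by (simp_all add: M_def K_def)
    have NMK: "N = M * K" using 1 by (simp add: N_def M_def K_def flip: power_add)
    have "(\<Prod>j\<in>UNIV. G (K * t) (a j) (b j)) * H (K * t)
       = of_bool (cond i) * (of_int N ^ ?m * of_int p ^ (i * ?m) * of_int p ^ i) *
         (\<Sum>w\<in>{0..<M}. int_char M (modular_inverse M t * (w^2 - n i)))" if t: "t \<in> residue_units M" for t
    proof -
      define s where "s = modular_inverse M t"
      have ts: "[t * s = 1] (mod M)"
        using t unfolding s_def by (intro cong_modular_inverse1) (simp add: residue_units_def)
      have G: "G (K * t) (a j) (b j) = of_bool (K dvd a j \<and> K dvd b j) *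
         (of_int N * of_int K * int_char M (- (s * ((a j div K) * (b j div K)))))" for j
        unfolding G_def NMK by (rule hyperbolic_plane_sum[OF M K(1) ts])
      have H: "H (K * t) = of_bool (K dvd c) * (of_int K * (\<Sum>w\<in>{0..<M}. int_char M (s * (w^2 - (c div K)^2))))"
        unfolding H_def NMK by (rule quadratic_line_sum[OF M K ts])
      show ?thesis
      proof (cases "cond i")
        case True
        have "(\<Prod>j\<in>UNIV. G (K * t) (a j) (b j))
            = (of_int N * of_int K) ^ ?m * int_char M (\<Sum>j\<in>UNIV. - (s * ((a j div K) * (b j div K))))"
          unfolding G int_char_sum using True by (simp add: cond_def K_def prod.distrib)
        hence "(\<Prod>j\<in>UNIV. G (K * t) (a j) (b j)) * H (K * t) = (of_int N * of_int K) ^ ?m * of_int K *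
           (\<Sum>w\<in>{0..<M}. int_char M ((\<Sum>j\<in>UNIV. - (s * ((a j div K) * (b j div K)))) + s * (w^2 - (c div K)^2)))"
          unfolding H int_char_add using True by (simp add: cond_def K_def sum_distrib_left mult_ac)
        also have "(\<lambda>w. (\<Sum>j\<in>UNIV. - (s * ((a j div K) * (b j div K)))) + s * (w^2 - (c div K)^2))
            = (\<lambda>w. s * (w^2 - n i))"
          by (simp add: fun_eq_iff n_def K_def sum_negf sum_distrib_left algebra_simps)
        finally show ?thesis using True
          by (simp add: s_def K_def power_mult_distrib mult_ac flip: power_mult)
      next
        case False
        hence "(\<exists>j. \<not> (K dvd a j \<and> K dvd b j)) \<or> \<not> K dvd c" by (auto simp: cond_def K_def)
        hence "(\<exists>j. G (K * t) (a j) (b j) = 0) \<or> H (K * t) = 0" unfolding G H by force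
        hence "(\<Prod>j\<in>UNIV. G (K * t) (a j) (b j)) * H (K * t) = 0" by (auto simp: prod_zero)
        thus ?thesis using False by simp
      qed
    qed
    hence "(\<Sum>t\<in>residue_units M. (\<Prod>j\<in>UNIV. G (K * t) (a j) (b j)) * H (K * t))
       = of_bool (cond i) * (of_int N ^ ?m * of_int p ^ (i * ?m) * of_int p ^ i) *
         (\<Sum>t\<in>residue_units M. (\<lambda>s. \<Sum>w\<in>{0..<M}. int_char M (s * (w^2 - n i))) (modular_inverse M t))"
      by (simp add: sum_distrib_left)
    also have "(\<Sum>t\<in>residue_units M. (\<lambda>s. \<Sum>w\<in>{0..<M}. int_char M (s * (w^2 - n i))) (modular_inverse M t))
      = (\<Sum>s\<in>residue_units M. \<Sum>w\<in>{0..<M}. int_char M (s * (w^2 - n i)))"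
      by (rule sum_units_modular_inverse[OF M])
    also have "\<dots> = of_int (p ^ (r - i)) * of_int (sqrt_count_diff p (r - i) (n i))"
      unfolding M_def by (rule sum_units_quadratic[OF p])
    finally show ?case unfolding M_def K_def .
  qed
  also have "\<dots> = of_int N * (of_int p ^ (r * ?m) *
     (\<Sum>i\<le>r. of_bool (cond i) * of_int p ^ (i * ?m) * of_int (sqrt_count_diff p (r - i) (n i))))"
    unfolding sum_distrib_left
  proof (intro sum.cong refl, goal_cases)
    case (1 i)
    \<comment> \<open>The p^i from the line and the p^(r-i) from the sum over units make up the N to
      be cancelled.\<close>
    hence "(of_int N :: complex) = of_int p ^ i * of_int p ^ (r - i)"
      by (simp add: N_def flip: power_add)
    moreover have "(of_int N :: complex) ^ ?m = of_int p ^ (r * ?m)" by (simp add: N_def power_mult)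
    ultimately show ?case by (simp add: mult_ac)
  qed
  finally show ?thesis using N by (simp add: cond_def n_def)
qed

section \<open>Square roots modulo prime powers\<close>

lemma sqrt_count_0 [simp]: "sqrt_count p 0 n = 1"
proof -
  have "{w \<in> {0..<p ^ 0}. p ^ 0 dvd w^2 - n} = {0}" by auto
  thus ?thesis by (simp add: sqrt_count_def)
qed

lemma sqrt_count_1_dvd:
  assumes p: "prime p" and "p dvd n"
  shows "sqrt_count p (Suc 0) n = 1"
proof -
  have p0: "p > 0" using p by (rule prime_gt_0_int)
  have "{w \<in> {0..<p ^ Suc 0}. p ^ Suc 0 dvd w^2 - n} = {0}"
  proof (intro equalityI subsetI)
    fix w assume w: "w \<in> {w \<in> {0..<p ^ Suc 0}. p ^ Suc 0 dvd w^2 - n}"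
    hence "p dvd w^2" using assms(2) dvd_diff_left_iff[of p n "w^2"] by simp
    hence "p dvd w" using p prime_dvd_power by blast
    thus "w \<in> {0}" using w by (auto dest: zdvd_imp_le)
  qed (use assms p0 in auto)
  thus ?thesis by (simp add: sqrt_count_def)
qed

text \<open>If y is a root, then w^2 - n = (w - y) (w + y) modulo p, so the roots are y and -y; they
  differ because p is odd and does not divide y.\<close>

lemma sqrt_count_1_unit:
  assumes p: "prime p" "odd p" and n: "\<not> p dvd n"
  shows "int (sqrt_count p (Suc 0) n) = 1 + Legendre n p"
proof -
  have p0: "p > 0" using p(1) by (rule prime_gt_0_int)
  have n0: "\<not> [n = 0] (mod p)" using n by (simp add: cong_0_iff)
  let ?S = "{w \<in> {0..<p ^ Suc 0}. p ^ Suc 0 dvd w^2 - n}"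
  show ?thesis
  proof (cases "QuadRes p n")
    case False
    hence "?S = {}" by (auto simp: QuadRes_def cong_iff_dvd_diff)
    thus ?thesis using False n0 by (simp only: sqrt_count_def Legendre_def) simp
  next
    case True
    then obtain y where y: "p dvd y^2 - n" by (auto simp: QuadRes_def cong_iff_dvd_diff)
    have py: "\<not> p dvd y"
    proof
      assume "p dvd y"
      hence "p dvd y^2" by (simp add: power2_eq_square)
      thus False using y n dvd_diff_right_iff by blast
    qed
    have iff: "p dvd w^2 - n \<longleftrightarrow> p dvd w - y \<or> p dvd w - (- y)" for w
    proof -
      have "p dvd w^2 - n \<longleftrightarrow> p dvd (w^2 - n) - (y^2 - n)"
        using y by (rule dvd_diff_left_iff[symmetric])
      also have "(w^2 - n) - (y^2 - n) = (w - y) * (w - (- y))"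
        by (simp add: algebra_simps power2_eq_square)
      finally show ?thesis using p by (simp only: prime_dvd_mult_iff)
    qed
    have "?S = {y mod p, (- y) mod p}"
    proof -
      have "w \<in> ?S \<longleftrightarrow> w \<in> {0..<p} \<and> ([w = y] (mod p) \<or> [w = - y] (mod p))" for w
        by (simp add: iff cong_iff_dvd_diff del: diff_minus_eq_add)
      moreover have "w \<in> {0..<p} \<and> ([w = y] (mod p) \<or> [w = - y] (mod p)) \<longleftrightarrow> w \<in> {y mod p, (- y) mod p}" for w
        using p0 by (auto simp: cong_def)
      ultimately show ?thesis by blast
    qed
    moreover have "y mod p \<noteq> (- y) mod p"
    proof
      assume "y mod p = (- y) mod p"
      hence "p dvd y - (- y)" by (simp only: cong_iff_dvd_diff[symmetric] cong_def)
      hence "p dvd 2 * y" by simp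
      moreover have "\<not> p dvd 2" using p primes_dvd_imp_eq[of p 2] by auto
      ultimately show False using py p prime_dvd_mult_iff by blast
    qed
    ultimately have "card ?S = 2" by (simp only: card_2_iff) blast
    thus ?thesis using True n0 by (simp add: sqrt_count_def Legendre_def)
  qed
qed

text \<open>Hensel lifting: for a root w modulo P, the lifts w + P z are governed by a linear
  congruence modulo p in z with slope 2 w. The slope is a unit, so exactly one z works.\<close>

lemma sqrt_count_lift:
  assumes p: "prime p" "odd p" and n: "\<not> p dvd n"
  shows "sqrt_count p (Suc (Suc j)) n = sqrt_count p (Suc j) n"
proof -
  have p0: "p > 0" using p(1) by (rule prime_gt_0_int)
  define P where "P = p ^ Suc j"
  have P: "P > 0" using p0 by (simp add: P_def)
  have one: "(\<Sum>z\<in>{0..<p}. of_bool (P * p dvd (w + P * z)^2 - n)) = (of_bool (P dvd w^2 - n) :: nat)" for w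
  proof (cases "P dvd w^2 - n")
    case False
    have "\<not> P * p dvd (w + P * z)^2 - n" for z
    proof
      assume "P * p dvd (w + P * z)^2 - n"
      hence "P dvd (w + P * z)^2 - n" by (rule dvd_mult_left)
      also have "(w + P * z)^2 - n = P * (2 * w * z + P * z^2) + (w^2 - n)"
        by (simp add: algebra_simps power2_eq_square)
      finally show False using False dvd_add_right_iff[of P "P * (2 * w * z + P * z^2)" "w^2 - n"] by simp
    qed
    thus ?thesis using False by simp
  next
    case True
    then obtain q where q: "w^2 - n = P * q" by blast
    have "\<not> p dvd w"
    proof
      assume "p dvd w"
      moreover have "p dvd P" by (simp add: P_def)
      ultimately have "p dvd w^2 - P * q" by (simp add: power2_eq_square)
      also have "w^2 - P * q = n" using q by simp
      finally show False using n by simp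
    qed
    moreover have "\<not> p dvd 2" using p primes_dvd_imp_eq[of p 2] by auto
    ultimately have "\<not> p dvd 2 * w" using p prime_dvd_mult_iff by blast
    hence "coprime (2 * w) p" using p prime_imp_coprime coprime_commute by blast
    then obtain t where t: "[2 * w * t = 1] (mod p)" using cong_solve_coprime_int by blast
    have "P * p dvd (w + P * z)^2 - n \<longleftrightarrow> p dvd 2 * w * z + q" for z
    proof -
      \<comment> \<open>The quadratic term P z^2 is divisible by p because P is a positive power of
        p.\<close>
      have eq: "(w + P * z)^2 - n = P * (p * (p ^ j * z^2) + (2 * w * z + q))"
        using q by (simp add: P_def algebra_simps power2_eq_square)
      have "P * p dvd (w + P * z)^2 - n \<longleftrightarrow> p dvd p * (p ^ j * z^2) + (2 * w * z + q)"
        unfolding eq using P by (subst dvd_mult_cancel_left) simp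
      also have "\<dots> \<longleftrightarrow> p dvd 2 * w * z + q" by (rule dvd_add_right_iff) simp
      finally show ?thesis .
    qed
    hence "(\<Sum>z\<in>{0..<p}. of_bool (P * p dvd (w + P * z)^2 - n)) = (\<Sum>z\<in>{0..<p}. (of_bool (p dvd 2 * w * z + q) :: nat))"
      by simp
    also have "\<dots> = (\<Sum>z\<in>{0..<p}. of_bool (p dvd z + q))"
      by (rule sum_residues_mult[of p "\<lambda>z. of_bool (p dvd z + q)" "2 * w" t])
        (use p0 t in \<open>simp_all add: dvd_eq_mod_eq_0 mod_simps\<close>)
    also have "\<dots> = (\<Sum>z\<in>{0..<p}. of_bool (p dvd z))"
      by (rule sum_residues_shift[of p "\<lambda>z. of_bool (p dvd z)"]) (use p0 in \<open>simp_all add: dvd_eq_mod_eq_0 mod_simps\<close>)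
    also have "\<dots> = (\<Sum>z\<in>{0..<p}. if z = 0 then 1 else 0)"
      by (intro sum.cong) (auto dest: zdvd_imp_le)
    also have "\<dots> = 1" using p0 by simp
    finally show ?thesis using True by simp
  qed
  have cnt: "card {w \<in> A. Q w} = (\<Sum>w\<in>A. of_bool (Q w))" if "finite A" for A :: "int set" and Q
    using that by (simp add: of_bool_def flip: sum.inter_filter)
  have "sqrt_count p (Suc (Suc j)) n = (\<Sum>w\<in>{0..<P * p}. of_bool (P * p dvd w^2 - n))"
    unfolding sqrt_count_def P_def power_Suc2[of p "Suc j"] by (rule cnt) simp
  also have "\<dots> = (\<Sum>w\<in>{0..<P}. \<Sum>z\<in>{0..<p}. of_bool (P * p dvd (w + P * z)^2 - n))"
    using P by (rule sum_residues_split)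
  also have "\<dots> = sqrt_count p (Suc j) n"
    unfolding one sqrt_count_def P_def[symmetric] by (rule cnt[symmetric]) simp
  finally show ?thesis .
qed

text \<open>A root would be divisible by p, so its square by p^2, while p n has valuation exactly
  1.\<close>

lemma sqrt_count_simple_zero:
  assumes p: "prime p" and n: "\<not> p dvd n"
  shows "sqrt_count p (Suc (Suc j)) (p * n) = 0"
proof -
  have p0: "p > 0" using p by (rule prime_gt_0_int)
  have False if "p ^ Suc (Suc j) dvd w^2 - p * n" for w
  proof -
    have 1: "p * p dvd w^2 - p * n" using that by (rule dvd_trans[rotated]) simp
    hence "p dvd w^2 - p * n" by (rule dvd_mult_left)
    hence "p dvd w^2" using dvd_diff_left_iff[of p "p * n" "w^2"] by simp
    hence "p dvd w" using p prime_dvd_power by blast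
    hence "p * p dvd w^2" by (simp add: power2_eq_square mult_dvd_mono)
    hence "p * p dvd w^2 - (w^2 - p * n)" using 1 by (rule dvd_diff)
    hence "p * p dvd p * n" by simp
    thus False using p0 n by simp
  qed
  hence "{w \<in> {0..<p ^ Suc (Suc j)}. p ^ Suc (Suc j) dvd w^2 - p * n} = {}" by blast
  thus ?thesis by (simp only: sqrt_count_def card.empty)
qed

text \<open>Every root is p v with v running modulo p^(j+1), but the condition on v is one modulo
  p^j; this overcount is the factor p.\<close>

lemma sqrt_count_square_mult:
  assumes p: "prime p"
  shows "int (sqrt_count p (Suc (Suc j)) (p^2 * n)) = p * int (sqrt_count p j n)"
proof -
  have p0: "p > 0" using p by (rule prime_gt_0_int)
  have iff: "p ^ Suc (Suc j) dvd (p * w)^2 - p^2 * n \<longleftrightarrow> p ^ j dvd w^2 - n" for w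
  proof -
    have eq: "(p * w)^2 - p^2 * n = p^2 * (w^2 - n)" "p ^ Suc (Suc j) = p^2 * p ^ j"
      by (simp_all add: algebra_simps power2_eq_square)
    show ?thesis unfolding eq using p0 by simp
  qed
  have "{w \<in> {0..<p ^ Suc (Suc j)}. p ^ Suc (Suc j) dvd w^2 - p^2 * n}
      = (\<lambda>w. p * w) ` {w \<in> {0..<p ^ Suc j}. p ^ j dvd w^2 - n}"
  proof (intro equalityI subsetI)
    fix w assume w: "w \<in> {w \<in> {0..<p ^ Suc (Suc j)}. p ^ Suc (Suc j) dvd w^2 - p^2 * n}"
    have "p dvd p ^ Suc (Suc j)" by simp
    hence "p dvd w^2 - p^2 * n" using w dvd_trans by blast
    hence "p dvd w^2" using dvd_diff_left_iff[of p "p^2 * n" "w^2"] by (simp add: power2_eq_square)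
    hence "p dvd w" using p prime_dvd_power by blast
    then obtain v where v: "w = p * v" by blast
    hence "v \<in> {0..<p ^ Suc j}" using w p0 by (auto simp: zero_le_mult_iff)
    thus "w \<in> (\<lambda>w. p * w) ` {w \<in> {0..<p ^ Suc j}. p ^ j dvd w^2 - n}" using w iff[of v] v by blast
  next
    fix w assume "w \<in> (\<lambda>w. p * w) ` {w \<in> {0..<p ^ Suc j}. p ^ j dvd w^2 - n}"
    then obtain v where v: "w = p * v" "v \<in> {0..<p ^ Suc j}" "p ^ j dvd v^2 - n" by blast
    hence "p * v < p * p ^ Suc j" "0 \<le> p * v" using p0 by auto
    thus "w \<in> {w \<in> {0..<p ^ Suc (Suc j)}. p ^ Suc (Suc j) dvd w^2 - p^2 * n}"
      using iff[of v] v by (simp add: mult_ac)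
  qed
  moreover have "inj_on (\<lambda>w. p * w) A" for A using p0 by (auto simp: inj_on_def)
  ultimately show ?thesis unfolding sqrt_count_wide[OF p0, symmetric] by (simp add: sqrt_count_def card_image)
qed

text \<open>The generating polynomial of the differences of the numbers of square roots of an integer of
  valuation \<open>n\<close> modulo the powers of \<open>p\<close>; for even \<open>n\<close>, \<open>c\<close> is the Legendre symbol of its unit part.\<close>

fun root_poly :: "int \<Rightarrow> int \<Rightarrow> nat \<Rightarrow> int poly" where
  "root_poly p c 0 = [:1, c:]"
| "root_poly p c (Suc 0) = [:1, 0, -1:]"
| "root_poly p c (Suc (Suc n)) = [:1, 0, -1:] + [:0, 0, p:] * root_poly p c n"

text \<open>Valuation 0: the root counts are 1, 1 + c, 1 + c, ... by Hensel lifting. Valuation 1: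
  they are 1, 1, 0, 0, .... Beyond that: 1, 1, and then p times the counts for n / p^2. The three
  clauses of \<open>root_poly\<close> record the differences of these sequences.\<close>

lemma coeff_root_poly:
  assumes p: "prime p" "odd p" and n: "n = p ^ \<nu> * u" "\<not> p dvd u" and c: "even \<nu> \<Longrightarrow> c = Legendre u p"
  shows "poly.coeff (root_poly p c \<nu>) j = sqrt_count_diff p j n"
  using n(1) c
proof (induction \<nu> arbitrary: n j rule: induct_nat_012)
  case 0
  hence nu: "n = u" and c: "c = Legendre u p" by simp_all
  have "sqrt_count_diff p 0 n = 1" "sqrt_count_diff p (Suc 0) n = c" "sqrt_count_diff p (Suc (Suc i)) n = 0" for i
    by (simp_all add: sqrt_count_diff_def nu c sqrt_count_1_unit[OF p n(2)] sqrt_count_lift[OF p n(2)])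
  thus ?case by (simp add: coeff_pCons split: nat.split)
next
  case 1
  hence nu: "n = p * u" by simp
  have "sqrt_count p (Suc 0) n = 1" using p by (intro sqrt_count_1_dvd) (simp_all add: nu)
  hence "sqrt_count_diff p 0 n = 1" "sqrt_count_diff p (Suc 0) n = 0" "sqrt_count_diff p (Suc (Suc 0)) n = - 1"
    "sqrt_count_diff p (Suc (Suc (Suc i))) n = 0" for i
    by (simp_all add: sqrt_count_diff_def sqrt_count_simple_zero[OF p(1) n(2), folded nu])
  thus ?case by (simp add: coeff_pCons split: nat.split)
next
  case (ge2 \<nu>)
  define n' where "n' = p ^ \<nu> * u"
  have nn': "n = p^2 * n'" using ge2.prems(1) by (simp add: n'_def power2_eq_square)
  have IH: "poly.coeff (root_poly p c \<nu>) j = sqrt_count_diff p j n'" for j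
    using ge2.prems(2) by (intro ge2.IH(1)) (auto simp: n'_def)
  have 1: "sqrt_count p (Suc 0) n = 1"
    using p by (intro sqrt_count_1_dvd) (simp_all add: nn' power2_eq_square)
  have 2: "int (sqrt_count p (Suc (Suc i)) n) = p * int (sqrt_count p i n')" for i
    unfolding nn' by (rule sqrt_count_square_mult[OF p(1)])
  have d0: "sqrt_count_diff p 0 m = 1" for m by (simp add: sqrt_count_diff_def)
  \<comment> \<open>The counts start 1, 1, p; in the recursion, p - 1 is the -1 of 1 - X^2 plus p
    times the constant coefficient 1.\<close>
  have d: "sqrt_count_diff p (Suc 0) n = 0" "sqrt_count_diff p (Suc (Suc 0)) n = p - 1"
    using 2[of 0] by (simp_all add: sqrt_count_diff_def 1)
  have dS: "sqrt_count_diff p (Suc (Suc (Suc i))) n = p * sqrt_count_diff p (Suc i) n'" for i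
    using 2[of i] 2[of "Suc i"] by (simp add: sqrt_count_diff_def right_diff_distrib)
  show ?case
    by (simp add: coeff_pCons IH d0 d dS split: nat.split)
qed

section \<open>Generating polynomials\<close>

text \<open>The polynomial \<open>T\<close> with \<open>(1 - c X) F = (1 - X\<^sup>2) T\<close>, where \<open>F\<close> is the generating polynomial
  \<open>root_poly p c n\<close> and \<open>l = n div 2\<close>.\<close>

fun euler_quotient :: "int \<Rightarrow> int \<Rightarrow> nat \<Rightarrow> int poly" where
  "euler_quotient p c 0 = 1"
| "euler_quotient p c (Suc l) = [:1, -c:] + [:0, 0, p:] * euler_quotient p c l"

text \<open>Both sides obey recursions with the same multiplier p X^2. The base cases are (1 - c X)
  (1 + c X) = 1 - X^2, from c^2 = 1, and c = 0 for odd valuation.\<close>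

lemma root_poly_euler_quotient:
  assumes "even n \<Longrightarrow> c^2 = 1" "odd n \<Longrightarrow> c = 0"
  shows "[:1, -c:] * root_poly p c n = [:1, 0, -1:] * euler_quotient p c (n div 2)"
  using assms
proof (induction n rule: induct_nat_012)
  case (ge2 n)
  have "[:1, -c:] * root_poly p c (Suc (Suc n))
      = [:1, -c:] * [:1, 0, -1:] + [:0, 0, p:] * ([:1, -c:] * root_poly p c n)"
    by (simp only: root_poly.simps distrib_left mult.left_commute)
  also have "[:1, -c:] * root_poly p c n = [:1, 0, -1:] * euler_quotient p c (n div 2)"
    using ge2 by (intro ge2.IH(1)) auto
  also have "[:1, -c:] * [:1, 0, -1:] + [:0, 0, p:] * ([:1, 0, -1:] * euler_quotient p c (n div 2))
      = [:1, 0, -1:] * euler_quotient p c (Suc (Suc n) div 2)"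
    by (simp only: euler_quotient.simps distrib_left mult.left_commute mult.commute[of "[:1, -c:]"] div2_Suc_Suc)
  finally show ?case .
qed (simp_all add: power2_eq_square one_pCons)

text \<open>Positivity of the leading coefficient travels with the induction to keep the polynomial
  nonzero, so that degrees add in the product with p X^2.\<close>

lemma euler_quotient_degree:
  assumes "p > 0"
  shows "degree (euler_quotient p c l) = 2 * l \<and> lead_coeff (euler_quotient p c l) > 0"
proof (induction l)
  case (Suc l)
  let ?T = "euler_quotient p c l"
  have T0: "?T \<noteq> 0" using Suc by auto
  have d: "degree ([:0, 0, p:] * ?T) = 2 * l + 2"
    using Suc T0 assms by (subst degree_mult_eq) auto
  have lt: "degree [:1, -c:] < degree ([:0, 0, p:] * ?T)"
    unfolding d by (rule order.strict_trans1[OF degree_pCons_le]) simp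
  have dS: "degree (euler_quotient p c (Suc l)) = 2 * l + 2"
    unfolding euler_quotient.simps degree_add_eq_right[OF lt] by (rule d)
  have "lead_coeff (euler_quotient p c (Suc l)) = lead_coeff ([:0, 0, p:] * ?T)"
    unfolding dS using coeff_eq_0[OF lt] d by (simp only: euler_quotient.simps coeff_add)
  also have "\<dots> = p * lead_coeff ?T"
    using assms by (subst lead_coeff_mult) simp
  finally have lc: "lead_coeff (euler_quotient p c (Suc l)) = p * lead_coeff ?T" .
  show ?case
  proof
    show "degree (euler_quotient p c (Suc l)) = 2 * Suc l" unfolding dS by simp
    show "lead_coeff (euler_quotient p c (Suc l)) > 0" unfolding lc using Suc assms by (blast intro: mult_pos_pos)
  qed
qed simp

abbreviation cpoly :: "int poly \<Rightarrow> complex poly" where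
  "cpoly \<equiv> map_poly of_int"

lemma cpoly_hom:
  "cpoly (P + Q) = cpoly P + cpoly Q" "cpoly (P * Q) = cpoly P * cpoly Q"
  "cpoly (Polynomial.smult a P) = Polynomial.smult (of_int a) (cpoly P)"
  "cpoly (pCons a P) = pCons (of_int a) (cpoly P)" "cpoly 0 = 0" "cpoly 1 = 1"
  "cpoly (\<Sum>i\<in>A. f i) = (\<Sum>i\<in>A. cpoly (f i))"
  by (simp_all add: of_int_poly_hom.hom_add of_int_poly_hom.hom_mult of_int_poly_hom.hom_sum
      of_int_hom.map_poly_pCons_hom of_int_hom.map_poly_hom_smult)

text \<open>Unrolled, T_l is the sum of p^j X^(2j) (1 - c X) over j < l, plus p^l X^(2l). The
  substitution X -> 1 / (p X) turns the defining recursion, which adds terms of low degree, into one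
  that adds terms of high degree; T satisfies both.\<close>

lemma euler_quotient_reciprocal:
  fixes X :: complex
  assumes p: "p > 0" and X: "X \<noteq> 0"
  shows "of_int p ^ l * X ^ (2 * l) * poly (cpoly (euler_quotient p c l)) (inverse (of_int p) * inverse X)
    = poly (cpoly (euler_quotient p c l)) X"
proof -
  define Y where "Y = inverse (of_int p :: complex) * inverse X"
  have XY: "of_int p * X * Y = 1" using p X by (simp add: Y_def field_simps)
  define S where "S l x = poly (cpoly (euler_quotient p c l)) x" for l x
  have S0: "S 0 x = 1" for x by (simp add: S_def cpoly_hom)
  have SS: "S (Suc l) x = 1 - of_int c * x + of_int p * x^2 * S l x" for l x
    by (simp add: S_def cpoly_hom power2_eq_square algebra_simps)
  text \<open>The recursion from the other end: it exchanges the lowest and the highest coefficients.\<close>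
  have top: "S (Suc l) x = S l x + of_int p ^ l * x ^ (2 * l) * (of_int p * x^2 - of_int c * x)" for l x
  proof (induction l)
    case (Suc l)
    have "S (Suc (Suc l)) x = 1 - of_int c * x + of_int p * x^2 *
        (S l x + of_int p ^ l * x ^ (2 * l) * (of_int p * x^2 - of_int c * x))"
      by (subst SS) (simp only: Suc)
    also have "\<dots> = S (Suc l) x + of_int p ^ Suc l * x ^ (2 * Suc l) * (of_int p * x^2 - of_int c * x)"
      unfolding SS[of l] by (simp add: algebra_simps power2_eq_square)
    finally show ?case .
  qed (simp add: SS S0 algebra_simps)
  have "of_int p ^ l * X ^ (2 * l) * S l Y = S l X"
  proof (induction l)
    case (Suc l)
    have "of_int p ^ Suc l * X ^ (2 * Suc l) * S (Suc l) Y
       = of_int p ^ l * X ^ (2 * l) * (of_int p * X^2 - of_int c * X * (of_int p * X * Y)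
           + (of_int p * X * Y)^2 * S l Y)"
      unfolding SS by (simp add: algebra_simps power2_eq_square)
    also have "\<dots> = S (Suc l) X"
      unfolding top XY Suc[symmetric] by (simp add: algebra_simps)
    finally show ?case .
  qed (simp add: S0)
  thus ?thesis by (simp add: S_def Y_def)
qed

definition density_poly :: "int \<Rightarrow> int \<Rightarrow> nat \<Rightarrow> nat \<Rightarrow> nat \<Rightarrow> int poly" where
  "density_poly p c m k L = (\<Sum>i\<le>k. Polynomial.monom (p ^ (m * i)) i * euler_quotient p c (L - i))"

text \<open>The i-th summand has degree at most i + 2 (L - i) = 2 L - i, so only i = 0 reaches 2 L
  and nothing can cancel it.\<close>

lemma degree_density_poly:
  assumes p: "p > 0" and k: "k \<le> L"
  shows "degree (density_poly p c m k L) = 2 * L"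
proof -
  have le: "degree (Polynomial.monom (p ^ (m * i)) i * euler_quotient p c (L - i)) \<le> 2 * L - i" if "i \<le> k" for i
    using degree_mult_le[of "Polynomial.monom (p ^ (m * i)) i" "euler_quotient p c (L - i)"]
      degree_monom_le[of "p ^ (m * i)" i] euler_quotient_degree[OF p, of c "L - i"] that k by simp
  have split: "density_poly p c m k L
      = euler_quotient p c L + (\<Sum>i\<in>{1..k}. Polynomial.monom (p ^ (m * i)) i * euler_quotient p c (L - i))"
  proof -
    have "{..k} = insert 0 {1..k}" by auto
    thus ?thesis by (simp add: density_poly_def monom_0)
  qed
  show ?thesis
  proof (cases "k = 0")
    case True
    thus ?thesis using split euler_quotient_degree[OF p, of c L] by simp
  next
    case False
    have "degree (Polynomial.monom (p ^ (m * i)) i * euler_quotient p c (L - i)) < 2 * L" if "i \<in> {1..k}" for i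
      using le[of i] that k by auto
    moreover have "2 * L > 0" using False k by simp
    ultimately have "degree (\<Sum>i\<in>{1..k}. Polynomial.monom (p ^ (m * i)) i * euler_quotient p c (L - i)) < 2 * L"
      by (intro degree_sum_less) auto
    thus ?thesis using split euler_quotient_degree[OF p, of c L] by (simp add: degree_add_eq_left)
  qed
qed

lemma poly_density_poly:
  "poly (cpoly (density_poly p c m k L)) X
    = (\<Sum>i\<le>k. (of_int p ^ m * X) ^ i * poly (cpoly (euler_quotient p c (L - i))) X)"
  unfolding density_poly_def cpoly_hom(7) poly_sum cpoly_hom(2) poly_mult
  by (intro sum.cong refl arg_cong2[of _ _ _ _ "(*)"])
    (simp add: map_poly_monom poly_monom power_mult_distrib power_mult)

text \<open>Split L = i + (L - i). With Y = 1 / (p X), the factor (p X^2)^i turns (p^m Y)^i back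
  into (p^m X)^i, and the rest is the functional equation of T_(L-i).\<close>

lemma density_poly_reciprocal:
  fixes X :: complex
  assumes p: "p > 0" and X: "X \<noteq> 0" and k: "k \<le> L"
  shows "of_int p ^ L * X ^ (2 * L) * poly (cpoly (density_poly p c m k L)) (inverse (of_int p) * inverse X)
    = poly (cpoly (density_poly p c m k L)) X"
  unfolding poly_density_poly sum_distrib_left
proof (intro sum.cong refl, goal_cases)
  case (1 i)
  define Y where "Y = inverse (of_int p :: complex) * inverse X"
  have XY: "of_int p * X * Y = 1" using p X by (simp add: Y_def field_simps)
  have L: "L = i + (L - i)" using 1 k by simp
  let ?S = "\<lambda>x. poly (cpoly (euler_quotient p c (L - i))) x"
  have "of_int p ^ L * X ^ (2 * L) * ((of_int p ^ m * Y) ^ i * ?S Y)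
     = (of_int p * X * Y) ^ i * (of_int p ^ m * X) ^ i * (of_int p ^ (L - i) * X ^ (2 * (L - i)) * ?S Y)"
    by (subst (1 2) L) (simp add: power_add power_mult_distrib mult_2 mult_2_right mult_ac)
  also have "\<dots> = (of_int p ^ m * X) ^ i * ?S X"
    unfolding XY unfolding Y_def euler_quotient_reciprocal[OF p X] by simp
  finally show ?case unfolding Y_def .
qed

text \<open>Subtracting 2 i keeps the parity of the valuation, so the same c and the same factors 1
  - c X and 1 - X^2 serve every summand.\<close>

lemma density_poly_factorization:
  fixes X :: complex
  assumes "even \<nu> \<Longrightarrow> c^2 = 1" "odd \<nu> \<Longrightarrow> c = 0" and k: "2 * k \<le> \<nu>"
  shows "(1 - of_int c * X) * (\<Sum>i\<le>k. (of_int p ^ m * X) ^ i * poly (cpoly (root_poly p c (\<nu> - 2 * i))) X)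
    = (1 - X^2) * poly (cpoly (density_poly p c m k (\<nu> div 2))) X"
  unfolding poly_density_poly sum_distrib_left
proof (intro sum.cong refl, goal_cases)
  case (1 i)
  let ?n = "\<nu> - 2 * i"
  have "[:1, -c:] * root_poly p c ?n = [:1, 0, -1:] * euler_quotient p c (?n div 2)"
    using 1 k assms by (intro root_poly_euler_quotient) auto
  hence "poly (cpoly [:1, -c:]) X * poly (cpoly (root_poly p c ?n)) X
      = poly (cpoly [:1, 0, -1:]) X * poly (cpoly (euler_quotient p c (?n div 2))) X"
    by (metis cpoly_hom(2) poly_mult)
  moreover have "?n div 2 = \<nu> div 2 - i" by simp
  moreover have "poly (cpoly [:1, -c:]) X = 1 - of_int c * X" "poly (cpoly [:1, 0, -1:]) X = 1 - X^2"
    by (simp_all add: cpoly_hom power2_eq_square algebra_simps)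
  ultimately have "(1 - of_int c * X) * poly (cpoly (root_poly p c ?n)) X
      = (1 - X^2) * poly (cpoly (euler_quotient p c (\<nu> div 2 - i))) X"
    by simp
  thus ?case by (metis mult.left_commute)
qed

section \<open>The integral as a finite sum\<close>

lemma padic_integers_add: "x \<in> padic_integers \<Longrightarrow> y \<in> padic_integers \<Longrightarrow> x + y \<in> padic_integers"
  using padic_abs_add[of x y] by (auto simp: padic_integers_def)

lemma padic_integers_minus_iff: "- x \<in> padic_integers \<longleftrightarrow> x \<in> padic_integers"
  by (simp add: padic_integers_def padic_abs_minus)

lemma padic_integers_diff: "x \<in> padic_integers \<Longrightarrow> y \<in> padic_integers \<Longrightarrow> x - y \<in> padic_integers"
  using padic_integers_add[of x "- y"] by (simp add: padic_integers_minus_iff)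

lemma padic_integers_mult: "x \<in> padic_integers \<Longrightarrow> y \<in> padic_integers \<Longrightarrow> x * y \<in> padic_integers"
  by (simp add: padic_integers_def padic_abs_mult padic_abs_nonneg mult_le_one)

text \<open>The bridge by which p-adic integrality conditions become divisibility of
  integers.\<close>

lemma padic_integers_of_int_divide_iff:
  "(of_int z / of_nat CARD('p) ^ n :: 'p::prime_card padic) \<in> padic_integers \<longleftrightarrow> int CARD('p) ^ n dvd z"
proof -
  have "(of_int z / of_nat CARD('p) ^ n :: 'p padic) \<in> padic_integers
      \<longleftrightarrow> rat_pabs CARD('p) (of_int z) * real CARD('p) ^ n \<le> 1"
    by (simp only: padic_integers_def mem_Collect_eq padic_abs_divide_prime_power padic_abs_of_int of_nat_power)
  also have "\<dots> \<longleftrightarrow> rat_pabs CARD('p) (of_int z) \<le> 1 / real CARD('p) ^ n"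
    using prime_card_gt_1[where ?'p = 'p] by (simp add: field_simps)
  also have "\<dots> \<longleftrightarrow> int CARD('p) ^ n dvd z" by (rule rat_pabs_int_le_iff[OF prime_card])
  finally show ?thesis .
qed

lemma padic_integers_of_int: "of_int z \<in> (padic_integers :: 'p::prime_card padic set)"
  using padic_integers_of_int_divide_iff[of z 0, where ?'p = 'p] by simp

lemma padic_integers_0: "0 \<in> (padic_integers :: 'p::prime_card padic set)"
  using padic_integers_of_int[of 0] by simp

lemma padic_integers_sum:
  "(\<And>i. i \<in> A \<Longrightarrow> f i \<in> padic_integers) \<Longrightarrow> (\<Sum>i\<in>A. f i) \<in> (padic_integers :: 'p::prime_card padic set)"
  by (induction A rule: infinite_finite_induct) (simp_all add: padic_integers_add padic_integers_0)

lemma padic_integers_prime_power: "of_nat CARD('p) ^ n \<in> (padic_integers :: 'p::prime_card padic set)"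
  using padic_integers_of_int[of "int CARD('p) ^ n", where ?'p = 'p] by simp

lemma padic_prime_power_nonzero: "(of_nat CARD('p) ^ n :: 'p::prime_card padic) \<noteq> 0"
  using prime_card_gt_1[where ?'p = 'p] by simp

text \<open>The fractional part of x is (z mod p^n) / p^n, by its uniqueness.\<close>

lemma padic_char_eq_int_char:
  fixes x :: "'p::prime_card padic"
  assumes x: "x - of_int z / of_nat CARD('p) ^ n \<in> padic_integers"
  shows "padic_char x = int_char (int CARD('p) ^ n) z"
proof -
  define N where "N = int CARD('p) ^ n"
  have N: "N > 0" using prime_card_gt_1[where ?'p = 'p] by (simp add: N_def)
  define y where "y = z mod N"
  have y: "0 \<le> y" "y < N" using N by (auto simp: y_def)
  have Nrat: "(of_nat CARD('p) ^ n :: rat) = of_int N" by (simp add: N_def)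
  have "N dvd z - y" by (simp add: y_def)
  hence "(of_int (z - y) / of_nat CARD('p) ^ n :: 'p padic) \<in> padic_integers"
    unfolding padic_integers_of_int_divide_iff N_def .
  hence "(x - of_int z / of_nat CARD('p) ^ n) + of_int (z - y) / of_nat CARD('p) ^ n \<in> padic_integers"
    using x by (intro padic_integers_add)
  also have "(x - of_int z / of_nat CARD('p) ^ n) + of_int (z - y) / of_nat CARD('p) ^ n
      = x - of_int y / of_nat CARD('p) ^ n"
    by (simp add: diff_divide_distrib)
  also have "\<dots> = x - of_rat (of_int y / of_nat CARD('p) ^ n)"
    by (simp add: of_rat_divide of_rat_power)
  finally have mem: "x - of_rat (of_int y / of_nat CARD('p) ^ n) \<in> padic_integers" .
  have "padic_frac x = of_int y / of_nat CARD('p) ^ n"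
    unfolding padic_frac_def
  proof (rule the1_equality[OF padic_frac_ex1], intro conjI exI)
    show "of_int y / of_nat CARD('p) ^ n < (1 :: rat)" "0 \<le> (of_int y / of_nat CARD('p) ^ n :: rat)"
      unfolding Nrat using y N by simp_all
  qed (use mem in auto)
  hence "padic_char x = int_char N y"
    unfolding Nrat by (simp add: padic_char_def int_char_def cis_conv_exp of_rat_divide mult_ac)
  also have "\<dots> = int_char N z"
    using N by (intro int_char_cong) (auto simp: y_def)
  finally show ?thesis unfolding N_def .
qed

lemma qbilin_eq:
  "qbilin x y = (\<Sum>j\<in>UNIV. x $ Inl j * y $ Inr (Inl j) + x $ Inr (Inl j) * y $ Inl j)
     + 2 * x $ Inr (Inr ()) * y $ Inr (Inr ())"
  by (simp add: qbilin_def qform_def algebra_simps sum.distrib power2_eq_square)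

lemma lattice_translate:
  "(+) a ` integral_lattice = {x :: ('p::prime_card, 'm::finite) qspace. \<forall>i. x $ i - a $ i \<in> padic_integers}"
proof (intro equalityI subsetI)
  fix x assume "x \<in> {x. \<forall>i. x $ i - a $ i \<in> padic_integers}"
  hence "x - a \<in> integral_lattice" by (simp add: integral_lattice_def)
  thus "x \<in> (+) a ` integral_lattice" by (intro image_eqI[of _ _ "x - a"]) auto
qed (auto simp: integral_lattice_def)

text \<open>A translate of the lattice is a product of closed balls of radius 1, hence
  closed.\<close>

lemma lattice_translate_borel:
  "(+) a ` integral_lattice \<in> sets (borel :: ('p::prime_card, 'm::finite) qspace measure)"
proof -
  have "(+) a ` integral_lattice = {x :: ('p, 'm) qspace. \<forall>i. x $ i \<in> cball (a $ i) 1}"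
    unfolding lattice_translate mem_cball by (subst dist_commute) (simp add: padic_integers_def dist_padic_def)
  moreover have "closed \<dots>" by (intro closed_vector_box allI closed_cball)
  ultimately show ?thesis by simp
qed

lemma haar_measure_lattice_translate:
  fixes \<mu> :: "('p::prime_card, 'm::finite) qspace measure"
  assumes \<mu>: "normalized_haar_measure \<mu>"
  shows "(+) a ` integral_lattice \<in> sets \<mu>" "emeasure \<mu> ((+) a ` integral_lattice) = 1"
proof -
  have b: "(integral_lattice :: ('p, 'm) qspace set) \<in> sets borel"
    using lattice_translate_borel[of "0 :: ('p, 'm) qspace"] by simp
  show "(+) a ` integral_lattice \<in> sets \<mu>" "emeasure \<mu> ((+) a ` integral_lattice) = 1"
    using \<mu> b lattice_translate_borel[of a] unfolding normalized_haar_measure_def by simp_all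
qed

lemma scaled_lattice:
  "(*s) (1 / of_nat CARD('p) ^ r) ` integral_lattice
     = {x :: ('p::prime_card, 'm::finite) qspace. \<forall>i. of_nat CARD('p) ^ r * x $ i \<in> padic_integers}"
proof (intro equalityI subsetI)
  fix x :: "('p, 'm) qspace"
  assume "x \<in> {x. \<forall>i. of_nat CARD('p) ^ r * x $ i \<in> padic_integers}"
  hence "of_nat CARD('p) ^ r *s x \<in> integral_lattice" by (simp add: integral_lattice_def)
  moreover have "x = (1 / of_nat CARD('p) ^ r) *s (of_nat CARD('p) ^ r *s x)"
    using padic_prime_power_nonzero[of r, where ?'p = 'p] by (simp add: vec_eq_iff)
  ultimately show "x \<in> (*s) (1 / of_nat CARD('p) ^ r) ` integral_lattice" by blast
qed (use padic_prime_power_nonzero[of r, where ?'p = 'p] in \<open>auto simp: integral_lattice_def\<close>)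

section \<open>The dilated lattice as a finite union of cosets, and the summands of J\<close>

definition lattice_coset ::
    "nat \<Rightarrow> ('m + 'm + unit \<Rightarrow> int) \<Rightarrow> ('p::prime_card, 'm::finite) qspace set" where
  "lattice_coset r y = (+) (\<chi> i. of_int (y i) / of_nat CARD('p) ^ r) ` integral_lattice"

lemma mem_lattice_coset:
  "x \<in> lattice_coset r y \<longleftrightarrow> (\<forall>i. x $ i - of_int (y i) / of_nat CARD('p) ^ r \<in> padic_integers)"
  for x :: "('p::prime_card, 'm::finite) qspace"
  by (simp add: lattice_coset_def lattice_translate)

abbreviation residue_vectors :: "int \<Rightarrow> ('i \<Rightarrow> int) set" where
  "residue_vectors N \<equiv> PiE UNIV (\<lambda>_. {0..<N})"

text \<open>Coordinatewise, \<open>y0\<close> is the residue of p^r x modulo p^r. The form y = y0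
  makes a sum of coset indicators collapse to one term.\<close>

lemma scaled_lattice_cosets:
  fixes x :: "('p::prime_card, 'm::finite) qspace"
  assumes "x \<in> (*s) (1 / of_nat CARD('p) ^ r) ` integral_lattice"
  shows "\<exists>y0 \<in> residue_vectors (int CARD('p) ^ r). \<forall>y \<in> residue_vectors (int CARD('p) ^ r).
           x \<in> lattice_coset r y \<longleftrightarrow> y = y0"
proof -
  have eq: "(of_nat CARD('p) ^ r * x $ i - a) / of_nat CARD('p) ^ r = x $ i - a / of_nat CARD('p) ^ r" for i a
    using padic_prime_power_nonzero[of r, where ?'p = 'p] by (simp add: diff_divide_distrib)
  have "\<exists>!a. a \<in> {0..<int CARD('p) ^ r} \<and> x $ i - of_int a / of_nat CARD('p) ^ r \<in> padic_integers" for i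
    using assms padic_integer_approx[of "of_nat CARD('p) ^ r * x $ i" r] unfolding scaled_lattice eq by auto
  then obtain y0 where y0: "y0 i \<in> {0..<int CARD('p) ^ r}"
      "x $ i - of_int (y0 i) / of_nat CARD('p) ^ r \<in> padic_integers"
      "\<And>a. a \<in> {0..<int CARD('p) ^ r} \<Longrightarrow> x $ i - of_int a / of_nat CARD('p) ^ r \<in> padic_integers \<Longrightarrow> a = y0 i" for i
    by metis
  show ?thesis
  proof (intro bexI[of _ y0] ballI iffI)
    fix y assume "y \<in> residue_vectors (int CARD('p) ^ r)" "x \<in> lattice_coset r y"
    thus "y = y0" by (intro ext y0(3)) (auto simp: mem_lattice_coset PiE_iff)
  qed (use y0 in \<open>auto simp: mem_lattice_coset PiE_iff\<close>)
qed

lemma lattice_coset_subset: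
  fixes x :: "('p::prime_card, 'm::finite) qspace"
  assumes "x \<in> lattice_coset r y"
  shows "x \<in> (*s) (1 / of_nat CARD('p) ^ r) ` integral_lattice"
proof -
  have "of_nat CARD('p) ^ r * (x $ i - of_int (y i) / of_nat CARD('p) ^ r) + of_int (y i) \<in> padic_integers" for i
    using assms by (intro padic_integers_add padic_integers_mult padic_integers_prime_power padic_integers_of_int)
      (simp add: mem_lattice_coset)
  thus ?thesis
    using padic_prime_power_nonzero[of r, where ?'p = 'p] by (simp add: scaled_lattice right_diff_distrib)
qed

text \<open>The integrand is constant on cosets of volume 1, so it is a finite combination of
  indicators; integrability comes for free.\<close>

lemma set_integral_scaled_lattice:
  fixes \<mu> :: "('p::prime_card, 'm::finite) qspace measure" and f :: "('p, 'm) qspace \<Rightarrow> complex"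
  assumes \<mu>: "normalized_haar_measure \<mu>" and f: "\<And>x y. x \<in> lattice_coset r y \<Longrightarrow> f x = F y"
  shows "(LINT x : (*s) (1 / of_nat CARD('p) ^ r) ` integral_lattice | \<mu>. f x)
      = (\<Sum>y\<in>residue_vectors (int CARD('p) ^ r). F y)"
proof -
  let ?A = "(*s) (1 / of_nat CARD('p) ^ r) ` integral_lattice :: ('p, 'm) qspace set"
  let ?Y = "residue_vectors (int CARD('p) ^ r) :: ('m + 'm + unit \<Rightarrow> int) set"
  have fin: "finite ?Y" by (intro finite_PiE) auto
  have "indicator ?A x *\<^sub>R f x = (\<Sum>y\<in>?Y. indicator (lattice_coset r y) x *\<^sub>R F y)" for x
  proof (cases "x \<in> ?A")
    case True
    from bexE[OF scaled_lattice_cosets[OF this]] obtain y0 where y0: "y0 \<in> ?Y"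
        "\<forall>y\<in>?Y. x \<in> lattice_coset r y \<longleftrightarrow> y = y0" .
    have "(\<Sum>y\<in>?Y. indicator (lattice_coset r y) x *\<^sub>R F y) = (\<Sum>y\<in>?Y. if y = y0 then F y else 0)"
      using y0(2) by (intro sum.cong refl) (simp add: indicator_def)
    also have "\<dots> = F y0" using y0(1) fin by simp
    also have "\<dots> = f x" using y0 by (intro f[symmetric]) simp
    finally show ?thesis using True by simp
  next
    case False
    hence "x \<notin> lattice_coset r y" for y using lattice_coset_subset[of x r y] by argo
    thus ?thesis using False by simp
  qed
  moreover have "has_bochner_integral \<mu> (\<lambda>x. \<Sum>y\<in>?Y. indicator (lattice_coset r y) x *\<^sub>R F y)
      (\<Sum>y\<in>?Y. measure \<mu> (lattice_coset r y) *\<^sub>R F y)"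
    using haar_measure_lattice_translate[OF \<mu>]
    by (intro has_bochner_integral_sum has_bochner_integral_indicator) (simp_all add: lattice_coset_def)
  moreover have "measure \<mu> (lattice_coset r y) = 1" for y
    using haar_measure_lattice_translate(2)[OF \<mu>] by (simp add: measure_def lattice_coset_def)
  ultimately show ?thesis
    by (simp add: set_lebesgue_integral_def has_bochner_integral_integral_eq)
qed

text \<open>Replacing \<open>a\<close> by \<open>h\<close> changes it by a multiple of p^r, which
  absorbs the denominator p^r of x.\<close>

lemma padic_approx_mult:
  fixes a x :: "'p::prime_card padic"
  assumes "a \<in> padic_integers" "(a - of_int h) / of_nat CARD('p) ^ r \<in> padic_integers"
    and "x - of_int y / of_nat CARD('p) ^ r \<in> padic_integers"
  shows "a * x - of_int (h * y) / of_nat CARD('p) ^ r \<in> padic_integers"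
proof -
  have eq: "a * x - of_int (h * y) / of_nat CARD('p) ^ r
      = a * (x - of_int y / of_nat CARD('p) ^ r) + ((a - of_int h) / of_nat CARD('p) ^ r) * of_int y"
    using padic_prime_power_nonzero[of r, where ?'p = 'p] by (simp add: field_simps)
  show ?thesis
    unfolding eq by (intro padic_integers_add padic_integers_mult padic_integers_of_int padic_integers_prime_power assms)
qed

text \<open>The product has denominator p^(2r); the factor p^r keeps the cross terms integral.
  Applied to each term of q, it makes p^r q(x) and q(y) / p^r agree modulo p-adic integers.\<close>

lemma padic_approx_scaled_mult:
  fixes x x' :: "'p::prime_card padic"
  assumes "x - of_int y / of_nat CARD('p) ^ r \<in> padic_integers" "x' - of_int y' / of_nat CARD('p) ^ r \<in> padic_integers"
  shows "of_nat CARD('p) ^ r * (x * x') - of_int (y * y') / of_nat CARD('p) ^ r \<in> padic_integers"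
proof -
  let ?P = "of_nat CARD('p) ^ r :: 'p padic"
  have eq: "?P * (x * x') - of_int (y * y') / ?P
      = (x - of_int y / ?P) * (?P * (x' - of_int y' / ?P) + of_int y') + of_int y * (x' - of_int y' / ?P)"
    using padic_prime_power_nonzero[of r, where ?'p = 'p] by (simp add: field_simps)
  show ?thesis
    unfolding eq by (intro padic_integers_add padic_integers_mult padic_integers_of_int padic_integers_prime_power assms)
qed

definition int_qform :: "('m::finite + 'm + unit \<Rightarrow> int) \<Rightarrow> int" where
  "int_qform y = (\<Sum>j\<in>UNIV. y (Inl j) * y (Inr (Inl j))) + (y (Inr (Inr ())))^2"

definition int_qbilin :: "('m::finite + 'm + unit \<Rightarrow> int) \<Rightarrow> ('m + 'm + unit \<Rightarrow> int) \<Rightarrow> int" where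
  "int_qbilin h y = (\<Sum>j\<in>UNIV. h (Inl j) * y (Inr (Inl j)) + h (Inr (Inl j)) * y (Inl j))
     + 2 * h (Inr (Inr ())) * y (Inr (Inr ()))"

lemma J_summand_eq:
  fixes \<mu> :: "('p::prime_card, 'm::finite) qspace measure" and \<eta> :: "('p, 'm) qspace"
  assumes \<mu>: "normalized_haar_measure \<mu>" and \<eta>: "\<eta> \<in> integral_lattice"
    and h: "\<And>i. (\<eta> $ i - of_int (h i)) / of_nat CARD('p) ^ r \<in> padic_integers"
  shows "J_summand \<mu> s \<eta> r = of_nat CARD('p) powr (- of_nat r * s) *
    quadric_char_sum (int CARD('p)) r (\<lambda>j. h (Inl j)) (\<lambda>j. h (Inr (Inl j))) (h (Inr (Inr ())))"
proof -
  let ?N = "int CARD('p) ^ r" and ?P = "of_nat CARD('p) ^ r :: 'p padic"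
  define F where "F y = int_char ?N (int_qbilin h y) * of_bool (?N dvd int_qform y)" for y
  have "padic_char (qbilin \<eta> x) * of_bool (?P * qform x \<in> padic_integers) = F y"
    if x: "x \<in> lattice_coset r y" for x y
  proof -
    have d: "x $ i - of_int (y i) / ?P \<in> padic_integers" for i using x by (simp add: mem_lattice_coset)
    have e: "\<eta> $ i \<in> padic_integers" for i using \<eta> by (simp add: integral_lattice_def)
    have b: "\<eta> $ i * x $ j - of_int (h i * y j) / ?P \<in> padic_integers" for i j
      by (intro padic_approx_mult d e h)
    have "qbilin \<eta> x - of_int (int_qbilin h y) / ?P
       = (\<Sum>j\<in>UNIV. (\<eta> $ Inl j * x $ Inr (Inl j) - of_int (h (Inl j) * y (Inr (Inl j))) / ?P)
            + (\<eta> $ Inr (Inl j) * x $ Inl j - of_int (h (Inr (Inl j)) * y (Inl j)) / ?P))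
         + of_int 2 * (\<eta> $ Inr (Inr ()) * x $ Inr (Inr ()) - of_int (h (Inr (Inr ())) * y (Inr (Inr ()))) / ?P)"
      by (simp add: qbilin_eq int_qbilin_def sum.distrib sum_subtractf add_divide_distrib sum_divide_distrib algebra_simps)
    also have "\<dots> \<in> padic_integers" by (intro padic_integers_add padic_integers_mult padic_integers_sum padic_integers_of_int b)
    finally have 1: "padic_char (qbilin \<eta> x) = int_char ?N (int_qbilin h y)"
      by (rule padic_char_eq_int_char)
    have "?P * qform x - of_int (int_qform y) / ?P
       = (\<Sum>j\<in>UNIV. ?P * (x $ Inl j * x $ Inr (Inl j)) - of_int (y (Inl j) * y (Inr (Inl j))) / ?P)
         + (?P * (x $ Inr (Inr ()) * x $ Inr (Inr ())) - of_int (y (Inr (Inr ())) * y (Inr (Inr ()))) / ?P)"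
      by (simp add: qform_def int_qform_def sum_subtractf add_divide_distrib sum_divide_distrib
          sum_distrib_left distrib_left power2_eq_square)
    also have "\<dots> \<in> padic_integers" by (intro padic_integers_add padic_integers_sum padic_approx_scaled_mult d)
    finally have q: "?P * qform x - of_int (int_qform y) / ?P \<in> padic_integers" .
    have "?P * qform x \<in> padic_integers \<longleftrightarrow> of_int (int_qform y) / ?P \<in> padic_integers"
      using padic_integers_diff[OF _ q, of "?P * qform x"] padic_integers_add[OF _ q, of "of_int (int_qform y) / ?P"]
      by auto
    thus ?thesis using 1 by (simp add: F_def padic_integers_of_int_divide_iff)
  qed
  hence "(LINT x : (*s) (1 / of_nat CARD('p) ^ r) ` integral_lattice | \<mu>.
        padic_char (qbilin \<eta> x) * of_bool (?P * qform x \<in> padic_integers)) = (\<Sum>y\<in>residue_vectors ?N. F y)"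
    by (rule set_integral_scaled_lattice[OF \<mu>])
  also have "\<dots> = (\<Sum>(g, w)\<in>PiE UNIV (\<lambda>_. {0..<?N} \<times> {0..<?N}) \<times> {0..<?N}.
        of_bool (?N dvd (\<Sum>j\<in>UNIV. fst (g j) * snd (g j)) + w^2) *
        int_char ?N ((\<Sum>j\<in>UNIV. h (Inl j) * snd (g j) + h (Inr (Inl j)) * fst (g j)) + 2 * h (Inr (Inr ())) * w))"
  \<comment> \<open>Regroups the coordinates (u, v, u_0) of y into pairs (u_j, v_j), one for each
    plane, and the single coordinate w.\<close>
  proof (rule sum.reindex_bij_witness[of _
        "\<lambda>(g, w) i. case i of Inl j \<Rightarrow> fst (g j) | Inr (Inl j) \<Rightarrow> snd (g j) | Inr (Inr _) \<Rightarrow> w"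
        "\<lambda>y. (\<lambda>j. (y (Inl j), y (Inr (Inl j))), y (Inr (Inr ())))"], goal_cases)
    case (1 y)
    show ?case by (auto simp: fun_eq_iff split: sum.split)
  next
    case (5 y)
    show ?case by (simp add: F_def int_qbilin_def int_qform_def)
  qed (auto simp: PiE_iff mem_Times_iff split: sum.split)
  finally show ?thesis
    unfolding J_summand_def quadric_char_sum_def sum.cartesian_product by (simp only:)
qed

section \<open>Integer approximations of the vector\<close>

lemma padic_val_ge_iff:
  fixes x :: "'p::prime_card padic"
  shows "padic_val x \<ge> ereal (real n) \<longleftrightarrow> x / of_nat CARD('p) ^ n \<in> padic_integers"
proof (cases "x = 0")
  case True
  thus ?thesis by (simp add: padic_val_def padic_integers_0)
next
  case False
  hence x: "padic_abs x > 0" using padic_abs_nonneg[of x] padic_abs_0_iff[of x] by linarith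
  have p1: "real CARD('p) > 1" by (rule prime_card_gt_1)
  have "x / of_nat CARD('p) ^ n \<in> padic_integers \<longleftrightarrow> padic_abs x * real CARD('p) ^ n \<le> 1"
    by (simp only: padic_integers_def mem_Collect_eq padic_abs_divide_prime_power of_nat_power)
  also have "\<dots> \<longleftrightarrow> log CARD('p) (padic_abs x * real CARD('p) ^ n) \<le> 0"
    using p1 x by (subst log_le_zero_cancel_iff) auto
  also have "log CARD('p) (padic_abs x * real CARD('p) ^ n) = log CARD('p) (padic_abs x) + real n"
    using p1 x by (subst log_mult) (auto simp: log_nat_power)
  finally show ?thesis using False by (auto simp: padic_val_def)
qed

lemma padic_integers_divide_le:
  fixes x :: "'p::prime_card padic"
  assumes "x / of_nat CARD('p) ^ N \<in> padic_integers" "n \<le> N"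
  shows "x / of_nat CARD('p) ^ n \<in> padic_integers"
proof -
  have "x / of_nat CARD('p) ^ n = (x / of_nat CARD('p) ^ N) * of_nat CARD('p) ^ (N - n)"
    using padic_prime_power_nonzero[where ?'p = 'p] assms(2) by (simp add: power_diff)
  thus ?thesis using padic_integers_mult[OF assms(1) padic_integers_prime_power] by simp
qed

lemma padic_approx_dvd_iff:
  fixes x :: "'p::prime_card padic"
  assumes "(x - of_int a) / of_nat CARD('p) ^ N \<in> padic_integers" "n \<le> N"
  shows "int CARD('p) ^ n dvd a \<longleftrightarrow> x / of_nat CARD('p) ^ n \<in> padic_integers"
proof -
  let ?P = "of_nat CARD('p) ^ n :: 'p padic"
  have d: "x / ?P - of_int a / ?P \<in> padic_integers"
    using padic_integers_divide_le[OF assms] by (simp add: diff_divide_distrib)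
  have "int CARD('p) ^ n dvd a \<longleftrightarrow> of_int a / ?P \<in> padic_integers"
    by (rule padic_integers_of_int_divide_iff[symmetric])
  also have "\<dots> \<longleftrightarrow> x / ?P \<in> padic_integers"
    using padic_integers_diff[OF _ d, of "x / ?P"] padic_integers_add[OF _ d, of "of_int a / ?P"] by auto
  finally show ?thesis .
qed

lemma qform_approx:
  fixes \<eta> :: "('p::prime_card, 'm::finite) qspace"
  assumes \<eta>: "\<eta> \<in> integral_lattice"
    and h: "\<And>i. (\<eta> $ i - of_int (h i)) / of_nat CARD('p) ^ N \<in> padic_integers"
  shows "(qform \<eta> - of_int (int_qform h)) / of_nat CARD('p) ^ N \<in> padic_integers"
proof -
  let ?P = "of_nat CARD('p) ^ N :: 'p padic"
  have e: "\<eta> $ i \<in> padic_integers" for i using \<eta> by (simp add: integral_lattice_def)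
  have b: "(\<eta> $ i * \<eta> $ j - of_int (h i * h j)) / ?P \<in> padic_integers" for i j
  proof -
    have eq: "(\<eta> $ i * \<eta> $ j - of_int (h i * h j)) / ?P
        = \<eta> $ i * ((\<eta> $ j - of_int (h j)) / ?P) + ((\<eta> $ i - of_int (h i)) / ?P) * of_int (h j)"
      using padic_prime_power_nonzero[of N, where ?'p = 'p] by (simp add: field_simps)
    show ?thesis unfolding eq by (intro padic_integers_add padic_integers_mult e h padic_integers_of_int)
  qed
  have "(qform \<eta> - of_int (int_qform h)) / ?P
      = (\<Sum>j\<in>UNIV. (\<eta> $ Inl j * \<eta> $ Inr (Inl j) - of_int (h (Inl j) * h (Inr (Inl j)))) / ?P)
        + (\<eta> $ Inr (Inr ()) * \<eta> $ Inr (Inr ()) - of_int (h (Inr (Inr ())) * h (Inr (Inr ())))) / ?P"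
    by (simp add: qform_def int_qform_def power2_eq_square sum_subtractf add_divide_distrib
        diff_divide_distrib sum_divide_distrib)
  also have "\<dots> \<in> padic_integers" by (intro padic_integers_add padic_integers_sum b)
  finally show ?thesis .
qed

lemma padic_residue_cong:
  fixes x :: "'p::prime_card padic"
  assumes x: "x \<in> padic_integers" and u: "(x - of_int u) / of_nat CARD('p) \<in> padic_integers"
  shows "[padic_residue x = u] (mod int CARD('p))"
proof -
  have "(x - of_int (padic_residue x)) / of_nat CARD('p) \<in> padic_integers"
    unfolding padic_residue_def using theI'[OF padic_residue_ex1[OF x]] by blast
  hence "(x - of_int u) / of_nat CARD('p) - (x - of_int (padic_residue x)) / of_nat CARD('p) \<in> padic_integers"
    by (rule padic_integers_diff[OF u])
  also have "(x - of_int u) / of_nat CARD('p) - (x - of_int (padic_residue x)) / of_nat CARD('p)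
      = of_int (padic_residue x - u) / of_nat CARD('p) ^ 1"
    by (simp add: diff_divide_distrib)
  finally show ?thesis unfolding padic_integers_of_int_divide_iff by (simp add: cong_iff_dvd_diff)
qed

lemma Legendre_cong:
  assumes "[a = b] (mod p)"
  shows "Legendre a p = Legendre b p"
  using assms by (simp add: Legendre_def QuadRes_def cong_def)

text \<open>This is the source of the range i \<le> k in the final sum.\<close>

lemma prime_power_exactly_divides_iff:
  fixes \<eta> :: "('p::prime_card, 'm::finite) qspace"
  assumes "prime_power_exactly_divides k \<eta>"
  shows "(\<forall>j. \<eta> $ j / of_nat CARD('p) ^ i \<in> padic_integers) \<longleftrightarrow> i \<le> k"
proof -
  have M: "Min (range (\<lambda>j. padic_val (\<eta> $ j))) = ereal (real k)"
    using assms by (simp add: prime_power_exactly_divides_def)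
  have "(\<forall>j. padic_val (\<eta> $ j) \<ge> ereal (real i)) \<longleftrightarrow> Min (range (\<lambda>j. padic_val (\<eta> $ j))) \<ge> ereal (real i)"
    by (subst Min_ge_iff) auto
  also have "\<dots> \<longleftrightarrow> i \<le> k" unfolding M by simp
  finally show ?thesis unfolding padic_val_ge_iff .
qed

text \<open>As a polynomial in \<open>p\<^sup>m\<^sup>-\<^sup>s\<close>, this is \<open>J(s, \<eta>, \<Phi>\<^sub>p)\<close>.\<close>

definition J_poly :: "int \<Rightarrow> int \<Rightarrow> nat \<Rightarrow> nat \<Rightarrow> nat \<Rightarrow> int poly" where
  "J_poly p c m k \<nu> = (\<Sum>i\<le>k. Polynomial.monom (p ^ (m * i)) i * root_poly p c (\<nu> - 2 * i))"

text \<open>The summation runs over i \<le> r with an indicator of i \<le> k, which is the shape in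
  which the exponential sum arrives.\<close>

lemma coeff_J_poly:
  "poly.coeff (J_poly p c m k \<nu>) r
     = (\<Sum>i\<le>r. of_bool (i \<le> k) * p ^ (m * i) * poly.coeff (root_poly p c (\<nu> - 2 * i)) (r - i))"
proof -
  let ?g = "\<lambda>i. p ^ (m * i) * poly.coeff (root_poly p c (\<nu> - 2 * i)) (r - i)"
  have "poly.coeff (J_poly p c m k \<nu>) r = (\<Sum>i\<le>k. if i \<le> r then ?g i else 0)"
    by (simp add: J_poly_def coeff_sum coeff_monom_mult)
  also have "\<dots> = (\<Sum>i\<in>{i \<in> {..k}. i \<le> r}. ?g i)"
    by (rule sum.inter_filter[symmetric]) simp
  also have "{i \<in> {..k}. i \<le> r} = {i \<in> {..r}. i \<le> k}" by auto
  also have "(\<Sum>i\<in>{i \<in> {..r}. i \<le> k}. ?g i) = (\<Sum>i\<le>r. if i \<le> k then ?g i else 0)"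
    by (rule sum.inter_filter) simp
  also have "\<dots> = (\<Sum>i\<le>r. of_bool (i \<le> k) * p ^ (m * i) * poly.coeff (root_poly p c (\<nu> - 2 * i)) (r - i))"
    by (intro sum.cong) auto
  finally show ?thesis .
qed

lemma poly_J_poly:
  "poly (cpoly (J_poly p c m k \<nu>)) X
    = (\<Sum>i\<le>k. (of_int p ^ m * X) ^ i * poly (cpoly (root_poly p c (\<nu> - 2 * i))) X)"
  unfolding J_poly_def cpoly_hom(7) poly_sum cpoly_hom(2) poly_mult
  by (intro sum.cong refl arg_cong2[of _ _ _ _ "(*)"])
    (simp add: map_poly_monom poly_monom power_mult_distrib power_mult)

text \<open>The precision N exceeds the valuation of q(eta), so divisibility of q(h) by p^(nu+1) is
  still decided by eta, and q(eta) / p^nu agrees modulo p with the unit part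
  \<open>u\<close>.\<close>

lemma qform_unit_approx:
  fixes \<eta> :: "('p::prime_card, 'm::finite) qspace"
  assumes \<eta>: "\<eta> \<in> integral_lattice" and \<nu>: "padic_val (qform \<eta>) = ereal (real \<nu>)"
    and h: "\<And>i. (\<eta> $ i - of_int (h i)) / of_nat CARD('p) ^ N \<in> padic_integers" and N: "\<nu> < N"
  obtains u where "int_qform h = int CARD('p) ^ \<nu> * u" "\<not> int CARD('p) dvd u"
    "Legendre (padic_residue (qform \<eta> / of_nat CARD('p) ^ \<nu>)) (int CARD('p)) = Legendre u (int CARD('p))"
proof -
  define P where "P = int CARD('p)"
  have P0: "P > 0" using prime_card_gt_1[where ?'p = 'p] by (simp add: P_def)
  define n where "n = int_qform h"
  have q: "(qform \<eta> - of_int n) / of_nat CARD('p) ^ N \<in> padic_integers"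
    unfolding n_def by (rule qform_approx[OF \<eta> h])
  have val: "P ^ i dvd n \<longleftrightarrow> i \<le> \<nu>" if "i \<le> N" for i
    unfolding P_def padic_approx_dvd_iff[OF q that] padic_val_ge_iff[symmetric] \<nu> by simp
  then obtain u where u: "n = P ^ \<nu> * u" using N by (metis dvdE le_refl less_imp_le)
  have "\<not> P ^ Suc \<nu> dvd n" using val[of "Suc \<nu>"] N by simp
  hence Pu: "\<not> P dvd u" using P0 by (simp add: u)
  have q\<nu>: "qform \<eta> / of_nat CARD('p) ^ \<nu> \<in> padic_integers"
    unfolding padic_val_ge_iff[symmetric] \<nu> by simp
  have leg: "Legendre (padic_residue (qform \<eta> / of_nat CARD('p) ^ \<nu>)) P = Legendre u P"
  proof -
    have "(qform \<eta> - of_int n) / of_nat CARD('p) ^ Suc \<nu> \<in> padic_integers"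
      using N by (intro padic_integers_divide_le[OF q]) simp
    also have "(qform \<eta> - of_int n) / of_nat CARD('p) ^ Suc \<nu>
        = (qform \<eta> / of_nat CARD('p) ^ \<nu> - of_int u) / of_nat CARD('p)"
      using padic_prime_power_nonzero[of \<nu>, where ?'p = 'p] by (simp add: u P_def field_simps)
    finally show ?thesis unfolding P_def by (intro Legendre_cong padic_residue_cong q\<nu>)
  qed
  show thesis using that[of u] u Pu leg by (simp add: n_def P_def)
qed

text \<open>The Legendre symbol is that of an integer prime to p, hence 1 or -1; the vector
  \<open>h\<close> only supplies this integer.\<close>

lemma chi_eta_square:
  fixes \<eta> :: "('p::prime_card, 'm::finite) qspace"
  assumes "\<eta> \<in> integral_lattice" "padic_val (qform \<eta>) = ereal (real \<nu>)"
    and "\<And>i. (\<eta> $ i - of_int (h i)) / of_nat CARD('p) ^ Suc \<nu> \<in> padic_integers" "even \<nu>"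
  shows "(chi_eta \<nu> \<eta>)\<^sup>2 = 1"
proof -
  obtain u where "\<not> int CARD('p) dvd u"
      "Legendre (padic_residue (qform \<eta> / of_nat CARD('p) ^ \<nu>)) (int CARD('p)) = Legendre u (int CARD('p))"
    by (rule qform_unit_approx[OF assms(1-3)]) auto
  thus ?thesis using assms(4) by (simp add: chi_eta_def Legendre_def cong_0_iff)
qed

text \<open>The precision N does two things: r \<le> N makes divisibility of \<open>h\<close> by p^i
  the same as that of eta for all i \<le> r, and \<nu> < N gives q(h) the valuation of
  q(eta).\<close>

lemma quadric_char_sum_coeff_J_poly:
  fixes \<eta> :: "('p::prime_card, 'm::finite) qspace" and h :: "'m + 'm + unit \<Rightarrow> int"
  assumes odd: "odd CARD('p)" and \<eta>: "\<eta> \<in> integral_lattice"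
    and k: "prime_power_exactly_divides k \<eta>"
    and \<nu>: "padic_val (qform \<eta>) = ereal (real \<nu>)" "2 * k \<le> \<nu>"
    and h: "\<And>i. (\<eta> $ i - of_int (h i)) / of_nat CARD('p) ^ N \<in> padic_integers"
    and N: "r \<le> N" "\<nu> < N"
  shows "quadric_char_sum (int CARD('p)) r (\<lambda>j. h (Inl j)) (\<lambda>j. h (Inr (Inl j))) (h (Inr (Inr ())))
    = of_nat CARD('p) ^ (r * CARD('m)) * of_int (poly.coeff (J_poly (int CARD('p)) (chi_eta \<nu> \<eta>) CARD('m) k \<nu>) r)"
proof -
  define P where "P = int CARD('p)"
  have P: "prime P" unfolding P_def using prime_card[where ?'a = 'p] by simp
  have P0: "P > 0" using P by (rule prime_gt_0_int)
  have oddP: "odd P" using odd by (simp add: P_def)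
  obtain u where u: "int_qform h = P ^ \<nu> * u" and Pu: "\<not> P dvd u"
    and leg: "Legendre (padic_residue (qform \<eta> / of_nat CARD('p) ^ \<nu>)) P = Legendre u P"
    unfolding P_def by (rule qform_unit_approx[OF \<eta> \<nu>(1) h N(2)])
  have cond: "((\<forall>j. P ^ i dvd h (Inl j) \<and> P ^ i dvd h (Inr (Inl j))) \<and> P ^ i dvd h (Inr (Inr ()))) \<longleftrightarrow> i \<le> k"
    if "i \<le> r" for i
  proof -
    have "P ^ i dvd h j \<longleftrightarrow> \<eta> $ j / of_nat CARD('p) ^ i \<in> padic_integers" for j
      unfolding P_def using that N by (intro padic_approx_dvd_iff[OF h]) simp
    moreover have "(\<forall>j. Q j) \<longleftrightarrow> (\<forall>j. Q (Inl j) \<and> Q (Inr (Inl j))) \<and> Q (Inr (Inr ()))" for Q :: "'m + 'm + unit \<Rightarrow> bool"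
      by (metis sum.exhaust unit.exhaust)
    ultimately show ?thesis using prime_power_exactly_divides_iff[OF k, of i] by simp
  qed
  have summand: "sqrt_count_diff P j ((\<Sum>j\<in>UNIV. (h (Inl j) div P ^ i) * (h (Inr (Inl j)) div P ^ i)) + (h (Inr (Inr ())) div P ^ i)^2)
      = poly.coeff (root_poly P (chi_eta \<nu> \<eta>) (\<nu> - 2 * i)) j" if i: "i \<le> r" "i \<le> k" for i j
  proof -
    let ?n = "(\<Sum>j\<in>UNIV. (h (Inl j) div P ^ i) * (h (Inr (Inl j)) div P ^ i)) + (h (Inr (Inr ())) div P ^ i)^2"
    have dv: "P ^ i dvd h (Inl j)" "P ^ i dvd h (Inr (Inl j))" "P ^ i dvd h (Inr (Inr ()))" for j
      using cond[OF i(1)] i(2) by blast+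
    have e: "P ^ i * (h (Inl j) div P ^ i) = h (Inl j)" "P ^ i * (h (Inr (Inl j)) div P ^ i) = h (Inr (Inl j))"
      "P ^ i * (h (Inr (Inr ())) div P ^ i) = h (Inr (Inr ()))" for j
      using dv(1)[of j] dv(2)[of j] dv(3) by simp_all
    \<comment> \<open>Since q is homogeneous of degree 2, dividing \<open>h\<close> by P^i lowers
      the valuation of q(h) by 2 i and keeps its unit part.\<close>
    have "(P ^ i * P ^ i) * ?n = (\<Sum>j\<in>UNIV. (P ^ i * (h (Inl j) div P ^ i)) * (P ^ i * (h (Inr (Inl j)) div P ^ i)))
        + (P ^ i * (h (Inr (Inr ())) div P ^ i))^2"
      by (simp only: distrib_left sum_distrib_left power_mult_distrib power2_eq_square mult_ac)
    also have "\<dots> = P ^ (i + i + (\<nu> - 2 * i)) * u"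
      unfolding e using i \<nu>(2) u by (simp add: int_qform_def)
    also have "\<dots> = (P ^ i * P ^ i) * (P ^ (\<nu> - 2 * i) * u)"
      by (simp only: power_add mult.assoc)
    finally have n: "?n = P ^ (\<nu> - 2 * i) * u" using P0 by simp
    have "chi_eta \<nu> \<eta> = Legendre u P" if "even (\<nu> - 2 * i)"
      using that i \<nu>(2) leg by (simp add: chi_eta_def P_def)
    thus ?thesis using coeff_root_poly[OF P oddP n Pu] by simp
  qed
  have "quadric_char_sum P r (\<lambda>j. h (Inl j)) (\<lambda>j. h (Inr (Inl j))) (h (Inr (Inr ())))
     = of_int P ^ (r * CARD('m)) * (\<Sum>i\<le>r. of_bool (i \<le> k) * of_int P ^ (i * CARD('m)) *
         of_int (poly.coeff (root_poly P (chi_eta \<nu> \<eta>) (\<nu> - 2 * i)) (r - i)))"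
    unfolding quadric_char_sum_eq[OF P oddP]
  proof (intro arg_cong[of _ _ "(*) _"] sum.cong refl, goal_cases)
    case (1 i)
    thus ?case using cond[of i] summand[of i "r - i"] by (cases "i \<le> k") simp_all
  qed
  thus ?thesis unfolding coeff_J_poly P_def by (simp add: mult_ac)
qed

section \<open>Summation over r and the zeros of the denominator\<close>

lemma nat_powr_mult_power:
  fixes s :: complex
  assumes "p > 0"
  shows "of_nat p powr (- of_nat r * s) * of_nat p ^ (r * m) = (of_nat p powr (of_nat m - s)) ^ r"
proof -
  have "(of_nat p powr (of_nat m - s)) ^ r = of_nat p powr (of_nat r * (of_nat m - s))"
    using assms by (simp add: powr_def exp_of_nat_mult[symmetric] mult.assoc)
  also have "of_nat r * (of_nat m - s) = - of_nat r * s + of_nat (r * m)" by (simp add: algebra_simps)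
  also have "of_nat p powr \<dots> = of_nat p powr (- of_nat r * s) * of_nat p ^ (r * m)"
    using assms powr_nat[of "of_nat p" "r * m"] unfolding powr_add by simp
  finally show ?thesis ..
qed

lemma poly_sums:
  fixes P :: "complex poly"
  shows "(\<lambda>r. poly.coeff P r * X ^ r) sums poly P X"
  unfolding poly_altdef by (rule sums_finite) (auto simp: coeff_eq_0 not_le)

text \<open>A simple zero is isolated, since the difference quotient stays away from 0; elsewhere
  continuity suffices. It is meant for the denominator 1 - c p^(m-s).\<close>

lemma has_field_derivative_nonzero_imp_eventually_ne:
  fixes f :: "'a::real_normed_field \<Rightarrow> 'a"
  assumes f: "(f has_field_derivative D) (at s)" and D: "f s = 0 \<Longrightarrow> D \<noteq> 0"
  shows "eventually (\<lambda>x. f x \<noteq> 0) (at s)"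
proof (cases "f s = 0")
  case True
  have "((\<lambda>x. (f x - f s) / (x - s)) \<longlongrightarrow> D) (at s)"
    using f by (simp add: has_field_derivative_iff)
  hence "eventually (\<lambda>x. (f x - f s) / (x - s) \<noteq> 0) (at s)"
    using D True by (intro tendsto_imp_eventually_ne) auto
  thus ?thesis by eventually_elim (use True in auto)
next
  case False
  have "(f \<longlongrightarrow> f s) (at s)" using DERIV_isCont[OF f] by (simp add: isCont_def)
  thus ?thesis using False by (rule tendsto_imp_eventually_ne)
qed

theorem theorem4p3:
  fixes \<mu> :: "('p::prime_card, 'm::finite) qspace measure"
    and \<eta> :: "('p, 'm) qspace"
    and p m k k' L :: nat
    and c :: complex
  assumes "p = CARD('p)" and "prime p" and "odd p"
    and "m = CARD('m)" and "m \<ge> 2"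
    and "normalized_haar_measure \<mu>"
    and "\<eta> \<in> integral_lattice"
    and "qform \<eta> \<noteq> 0"
    and "prime_power_exactly_divides k \<eta>"
    and "padic_val (qform \<eta>) = ereal (real (2 * k + k'))"
    and "c = of_int (chi_eta (2 * k + k') \<eta>)"
    and "L = (2 * k + k') div 2"
  shows "\<exists>Q :: int poly.
           degree Q = 2 * L \<and>
           (\<forall>X :: complex. X \<noteq> 0 \<longrightarrow>
              of_nat p ^ L * X ^ (2 * L) * poly (map_poly of_int Q) (inverse (of_nat p) * inverse X)
                = poly (map_poly of_int Q) X) \<and>
           (let rhs = (\<lambda>s :: complex.
                  (1 - of_nat p powr (2 * (of_nat m - s))) / (1 - c * of_nat p powr (of_nat m - s))
                    * poly (map_poly of_int Q) (of_nat p powr (of_nat m - s)))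
            in \<forall>s. summable (J_summand \<mu> s \<eta>) \<and>
                 (1 - c * of_nat p powr (of_nat m - s) \<noteq> 0 \<longrightarrow> J_integral \<mu> s \<eta> = rhs s) \<and>
                 (rhs \<longlongrightarrow> J_integral \<mu> s \<eta>) (at s))"
proof -
  define \<nu> where "\<nu> = 2 * k + k'"
  define P where "P = int p"
  define \<epsilon> where "\<epsilon> = chi_eta \<nu> \<eta>"
  define Q where "Q = density_poly P \<epsilon> m k (\<nu> div 2)"
  define G where "G = J_poly P \<epsilon> m k \<nu>"
  define X where "X s = of_nat p powr (of_nat m - s)" for s :: complex
  have p1: "p > 1" using \<open>prime p\<close> by (rule prime_gt_1_nat)
  have P0: "P > 0" using p1 by (simp add: P_def)
  have c: "c = of_int \<epsilon>" using assms(11) by (simp add: \<epsilon>_def \<nu>_def)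
  have L: "L = \<nu> div 2" using assms(12) by (simp add: \<nu>_def)
  have \<nu>: "padic_val (qform \<eta>) = ereal (real \<nu>)" "2 * k \<le> \<nu>" using assms(10) by (simp_all add: \<nu>_def)
  have odd: "odd CARD('p)" using assms by simp

  have approx: "\<exists>h. \<forall>i. (\<eta> $ i - of_int (h i)) / of_nat CARD('p) ^ N \<in> padic_integers" for N
  proof -
    have "\<exists>a. (\<eta> $ i - of_int a) / of_nat CARD('p) ^ N \<in> padic_integers" for i
      using padic_integer_approx[of "\<eta> $ i" N] assms(7) by (auto simp: integral_lattice_def)
    thus ?thesis by metis
  qed
  have summand: "J_summand \<mu> s \<eta> r = poly.coeff (cpoly G) r * X s ^ r" for s r
  proof -
    \<comment> \<open>Large enough for both demands on the precision, N \<ge> r and N >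
      \<nu>.\<close>
    define N where "N = r + \<nu> + 1"
    obtain h where h: "\<And>i. (\<eta> $ i - of_int (h i)) / of_nat CARD('p) ^ N \<in> padic_integers"
      using approx by blast
    have "J_summand \<mu> s \<eta> r = of_nat CARD('p) powr (- of_nat r * s) *
      quadric_char_sum (int CARD('p)) r (\<lambda>j. h (Inl j)) (\<lambda>j. h (Inr (Inl j))) (h (Inr (Inr ())))"
      using padic_integers_divide_le[OF h, of r] assms(6,7) by (intro J_summand_eq) (auto simp: N_def)
    also have "\<dots> = of_nat p powr (- of_nat r * s) * (of_nat p ^ (r * m) * of_int (poly.coeff G r))"
      using quadric_char_sum_coeff_J_poly[OF odd assms(7,9) \<nu> h, of r]
      by (simp add: N_def G_def P_def \<epsilon>_def assms(1,4))
    also have "\<dots> = poly.coeff (cpoly G) r * X s ^ r"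
      using nat_powr_mult_power[of p r s m] p1 by (simp add: X_def coeff_map_poly mult_ac)
    finally show ?thesis .
  qed
  have sums: "J_summand \<mu> s \<eta> sums poly (cpoly G) (X s)" for s
    unfolding summand by (rule poly_sums)
  hence J: "J_integral \<mu> s \<eta> = poly (cpoly G) (X s)" for s
    unfolding J_integral_def by (rule sums_unique[symmetric])

  have \<epsilon>1: "\<epsilon>\<^sup>2 = 1" if "even \<nu>"
  proof -
    obtain h where h: "\<And>i. (\<eta> $ i - of_int (h i)) / of_nat CARD('p) ^ Suc \<nu> \<in> padic_integers"
      using approx by blast
    show ?thesis using chi_eta_square[OF assms(7) \<nu>(1) h that] by (simp add: \<epsilon>_def)
  qed
  have \<epsilon>0: "\<epsilon> = 0" if "odd \<nu>" using that by (simp add: \<epsilon>_def chi_eta_def)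
  \<comment> \<open>Free of division, hence valid at the zeros of 1 - c x as well.\<close>
  have GQ: "(1 - c * x) * poly (cpoly G) x = (1 - x\<^sup>2) * poly (cpoly Q) x" for x
    unfolding c G_def Q_def poly_J_poly using \<epsilon>1 \<epsilon>0 \<nu>(2) by (intro density_poly_factorization)

  define rhs where "rhs s = (1 - of_nat p powr (2 * (of_nat m - s))) / (1 - c * of_nat p powr (of_nat m - s))
      * poly (cpoly Q) (of_nat p powr (of_nat m - s))" for s
  have rhs: "rhs s = poly (cpoly G) (X s)" if "1 - c * X s \<noteq> 0" for s
  proof -
    have "of_nat p powr (2 * (of_nat m - s)) = (X s)\<^sup>2"
      unfolding mult_2 powr_add X_def power2_eq_square ..
    hence "rhs s = (1 - (X s)\<^sup>2) * poly (cpoly Q) (X s) / (1 - c * X s)" by (simp add: rhs_def X_def)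
    also have "\<dots> = poly (cpoly G) (X s)" unfolding GQ[symmetric] using that by simp
    finally show ?thesis .
  qed
  have X': "(X has_field_derivative - (Ln (of_nat p) * X s)) (at s)" for s
  proof -
    have "((\<lambda>s. of_nat m - s :: complex) has_field_derivative - 1) (at s)"
      by (auto intro!: derivative_eq_intros)
    from DERIV_chain2[OF has_field_derivative_powr_right this, of "of_nat p"] show ?thesis
      using p1 by (simp add: X_def[abs_def])
  qed
  have lim: "(rhs \<longlongrightarrow> J_integral \<mu> s \<eta>) (at s)" for s
  proof -
    have "((\<lambda>s. 1 - c * X s) has_field_derivative c * (Ln (of_nat p) * X s)) (at s)"
      using X'[of s] by (auto intro!: derivative_eq_intros)
    \<comment> \<open>At a zero of the denominator c X = 1, so the derivative is log p, which is
      nonzero.\<close>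
    moreover have "c * (Ln (of_nat p) * X s) \<noteq> 0" if "1 - c * X s = 0"
      using that p1 by (auto simp: Ln_eq_zero_iff X_def)
    ultimately have "eventually (\<lambda>s. 1 - c * X s \<noteq> 0) (at s)"
      by (rule has_field_derivative_nonzero_imp_eventually_ne)
    hence "eventually (\<lambda>s. poly (cpoly G) (X s) = rhs s) (at s)"
      by eventually_elim (use rhs in auto)
    \<comment> \<open>J is continuous in s, so its value at s is the limit of the quotient from the
      nearby points.\<close>
    moreover have "((\<lambda>s. poly (cpoly G) (X s)) \<longlongrightarrow> poly (cpoly G) (X s)) (at s)"
      using DERIV_isCont[OF X'] by (intro tendsto_poly) (simp add: isCont_def)
    ultimately show ?thesis unfolding J by (rule Lim_transform_eventually[rotated])
  qed

  have deg: "degree Q = 2 * L"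
    unfolding Q_def L using P0 \<nu>(2) by (intro degree_density_poly) auto
  have recip: "of_nat p ^ L * x ^ (2 * L) * poly (cpoly Q) (inverse (of_nat p) * inverse x) = poly (cpoly Q) x"
    if "x \<noteq> 0" for x
    using density_poly_reciprocal[OF P0 that, of k L \<epsilon> m] \<nu>(2) by (simp add: Q_def L P_def)
  show ?thesis
  proof (intro exI[of _ Q] conjI allI impI, goal_cases)
    case 3
    have "rhs = (\<lambda>s. (1 - of_nat p powr (2 * (of_nat m - s))) / (1 - c * of_nat p powr (of_nat m - s))
        * poly (cpoly Q) (of_nat p powr (of_nat m - s)))"
      by (simp add: rhs_def[abs_def])
    moreover have "1 - c * of_nat p powr (of_nat m - s) \<noteq> 0 \<longrightarrow> J_integral \<mu> s \<eta> = rhs s" for s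
      using rhs[of s] by (simp add: J X_def)
    ultimately show ?case using lim sums_summable[OF sums] unfolding Let_def by metis
  qed (use deg recip in auto)
qed

end
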